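(* Let $n=\dim S_{k,N}$, let $h=(h(1),\dots,h(n))$ be a sequence of $N$-admissible pairs, and assume that the Poincaré series $P_{h(i)}$ ($1\le i\le n$) form a basis of $S_{k,N}$. Let $\phi$ and $\psi$ be Jacobi forms in $S_{k,N}$. Then $$\langle\phi|\psi\rangle=\gamma_h(\phi)^t\,\Gamma_h^{-1}\,\overline{\gamma_h(\psi)}.$$
   Context: $S_{k,N}$ is the (finite-dimensional) space of Jacobi cusp forms of weight $k$ and index $N\ge 1$ on the full Jacobi group $\operatorname{SL}(2,\mathbb{Z})^J$, in the sense of Eichler–Zagier. An $N$-admissible pair is a pair of integers $(D,r)$ with $D<0$ and $D\equiv r^2\bmod 4N$. Every $\phi\in S_{k,N}$ has a Fourier development $\phi(\tau,z)=\sum C_\phi(D,r)\,q^{(r^2-D)/4N}\zeta^r$ over all $N$-admissible pairs $(D,r)$, where $q=e^{2\pi i\tau}$, $\zeta=e^{2\pi iz}$. The Petersson scalar product of $\phi,\psi\in S_{k,N}$ is $$\langle\phi|\psi\rangle=\int_{\mathcal D}\phi(\tau,z)\overline{\psi(\tau,z)}\,v^{k-3}e^{-4\pi Ny^2/v}\,du\,dv\,dx\,dy\qquad(\tau=u+iv,\ z=x+iy),$$ with $\mathcal D$ a fundamental domain for the action of $\operatorname{SL}(2,\mathbb{Z})^J$ on $\mathbb{H}\times\mathbb{C}$. For an $N$-admissible pair $a$, the Poincaré series $P_a$ is the unique element of $S_{k,N}$ with $\langle\phi|P_a\rangle=C_\phi(a)$ for all $\phi\in S_{k,N}$. The Gram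 matrix is $\Gamma_h=\left(C_{P_{h(i)}}(h(j))\right)_{1\le i,j\le n}$ (row index $i$, column index $j$), and $\gamma_h(\phi)=\left(C_\phi(h(1)),\dots,C_\phi(h(n))\right)^t$. *)

theory Defs
  imports
    "HOL-Analysis.Analysis"
    "HOL-Library.Function_Algebras"
    "HOL-Number_Theory.Cong"
    "Jordan_Normal_Form.Gauss_Jordan_Elimination"
begin

definition fun_scale :: "complex \<Rightarrow> ('p \<Rightarrow> complex) \<Rightarrow> 'p \<Rightarrow> complex"
  where "fun_scale c f = (\<lambda>p. c * f p)"

interpretation cfun: vector_space "fun_scale :: complex \<Rightarrow> ('p \<Rightarrow> complex) \<Rightarrow> 'p \<Rightarrow> complex"
  by unfold_locales (auto simp: fun_scale_def fun_eq_iff algebra_simps)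

definition jacobi_space :: "(complex \<times> complex) set"
  where "jacobi_space = {(\<tau>, z). Im \<tau> > 0}"

definition SL2Z :: "(int \<times> int \<times> int \<times> int) set"
  where "SL2Z = {(a, b, c, d). a * d - b * c = 1}"

text \<open>
  An element of the semidirect product of \<open>SL(2,\<int>)\<close> and \<open>\<int>\<^sup>2\<close> is a pair
  \<open>((a, b, c, d), (l, m))\<close>. Only its action is needed below, not its group law.
\<close>

definition jacobi_group :: "((int \<times> int \<times> int \<times> int) \<times> (int \<times> int)) set"
  where "jacobi_group = SL2Z \<times> UNIV"

fun jacobi_act ::
  "(int \<times> int \<times> int \<times> int) \<times> (int \<times> int) \<Rightarrow> complex \<times> complex \<Rightarrow> complex \<times> complex"
  where "jacobi_act ((a, b, c, d), (l, m)) (\<tau>, z) =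
    ((of_int a * \<tau> + of_int b) / (of_int c * \<tau> + of_int d),
     (z + of_int l * \<tau> + of_int m) / (of_int c * \<tau> + of_int d))"

text \<open>
  The translates cover almost every point, and distinct translates meet in a null set. The group
  acts faithfully: minus the identity matrix sends \<open>(\<tau>, z)\<close> to \<open>(\<tau>, -z)\<close>.
  Hence every element other than the identity has to be considered.
\<close>

definition jacobi_fundamental_domain :: "(complex \<times> complex) set \<Rightarrow> bool"
  where "jacobi_fundamental_domain F \<longleftrightarrow>
    F \<in> sets borel \<and> F \<subseteq> jacobi_space \<and>
    (AE p in lborel. p \<in> jacobi_space \<longrightarrow> (\<exists>g\<in>jacobi_group. jacobi_act g p \<in> F)) \<and>
    (\<forall>g\<in>jacobi_group. g \<noteq> ((1, 0, 0, 1), (0, 0)) \<longrightarrow>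
       {p \<in> F. jacobi_act g p \<in> F} \<in> null_sets lborel)"

definition admissible :: "nat \<Rightarrow> (int \<times> int) set"
  where "admissible N = {(D, r). D < 0 \<and> [D = r\<^sup>2] (mod (4 * int N))}"

definition holomorphic2_on :: "(complex \<times> complex \<Rightarrow> complex) \<Rightarrow> (complex \<times> complex) set \<Rightarrow> bool"
  where "holomorphic2_on f U \<longleftrightarrow>
    (\<forall>p\<in>U. \<exists>a b. (f has_derivative (\<lambda>(s, t). a * s + b * t)) (at p))"

text \<open>
  The term belonging to \<open>(D, r)\<close> is \<open>C(D, r) q\<^sup>n \<zeta>\<^sup>r\<close> with the integer
  \<open>n = (r\<^sup>2 - D) / 4N\<close>, and \<open>D < 0\<close> is the cusp condition \<open>r\<^sup>2 < 4Nn\<close>. The exponential is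
  written out so that no branch of a power occurs.
\<close>

definition has_jacobi_expansion ::
  "nat \<Rightarrow> (complex \<times> complex \<Rightarrow> complex) \<Rightarrow> (int \<times> int \<Rightarrow> complex) \<Rightarrow> bool"
  where "has_jacobi_expansion N \<phi> C \<longleftrightarrow>
    (\<forall>a. a \<notin> admissible N \<longrightarrow> C a = 0) \<and>
    (\<forall>\<tau> z. Im \<tau> > 0 \<longrightarrow>
      ((\<lambda>(D, r). C (D, r) *
          exp (2 * of_real pi * \<i> * (of_int (r\<^sup>2 - D) / of_nat (4 * N) * \<tau> + of_int r * z)))
        has_sum \<phi> (\<tau>, z)) (admissible N))"

text \<open>
  The first condition makes a function on the upper half plane times the complex plane a total
  function in a unique way. Without it the dimension would be infinite.
\<close>

definition jacobi_cusp_forms :: "int \<Rightarrow> nat \<Rightarrow> (complex \<times> complex \<Rightarrow> complex) set"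
  where "jacobi_cusp_forms k N = {\<phi>.
    (\<forall>p. p \<notin> jacobi_space \<longrightarrow> \<phi> p = 0) \<and>
    holomorphic2_on \<phi> jacobi_space \<and>
    (\<forall>(a, b, c, d)\<in>SL2Z. \<forall>\<tau> z. Im \<tau> > 0 \<longrightarrow>
      \<phi> ((of_int a * \<tau> + of_int b) / (of_int c * \<tau> + of_int d), z / (of_int c * \<tau> + of_int d)) =
      (of_int c * \<tau> + of_int d) powi k *
      exp (2 * of_real pi * \<i> * of_nat N * (of_int c * z\<^sup>2 / (of_int c * \<tau> + of_int d))) *
      \<phi> (\<tau>, z)) \<and>
    (\<forall>(l::int) (m::int) \<tau> z. Im \<tau> > 0 \<longrightarrow>
      \<phi> (\<tau>, z + of_int l * \<tau> + of_int m) =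
      exp (- 2 * of_real pi * \<i> * of_nat N * ((of_int l)\<^sup>2 * \<tau> + 2 * of_int l * z)) * \<phi> (\<tau>, z)) \<and>
    (\<exists>C. has_jacobi_expansion N \<phi> C)}"

definition jacobi_coeff :: "nat \<Rightarrow> (complex \<times> complex \<Rightarrow> complex) \<Rightarrow> int \<times> int \<Rightarrow> complex"
  where "jacobi_coeff N \<phi> = (THE C. has_jacobi_expansion N \<phi> C)"

text \<open>Here \<open>lborel\<close> on pairs of complex numbers is the measure \<open>du dv dx dy\<close>.\<close>

definition petersson ::
  "(complex \<times> complex) set \<Rightarrow> int \<Rightarrow> nat \<Rightarrow>
   (complex \<times> complex \<Rightarrow> complex) \<Rightarrow> (complex \<times> complex \<Rightarrow> complex) \<Rightarrow> complex"
  where "petersson F k N \<phi> \<psi> =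
    set_lebesgue_integral lborel F (\<lambda>(\<tau>, z). \<phi> (\<tau>, z) * cnj (\<psi> (\<tau>, z)) *
      of_real (Im \<tau> powi (k - 3) * exp (- 4 * pi * real N * (Im z)\<^sup>2 / Im \<tau>)))"

definition poincare ::
  "(complex \<times> complex) set \<Rightarrow> int \<Rightarrow> nat \<Rightarrow> int \<times> int \<Rightarrow> complex \<times> complex \<Rightarrow> complex"
  where "poincare F k N a = (THE P. P \<in> jacobi_cusp_forms k N \<and>
    (\<forall>\<phi>\<in>jacobi_cusp_forms k N. petersson F k N \<phi> P = jacobi_coeff N \<phi> a))"

definition coeff_vec ::
  "nat \<Rightarrow> (int \<times> int) list \<Rightarrow> (complex \<times> complex \<Rightarrow> complex) \<Rightarrow> complex vec"
  where "coeff_vec N h \<phi> = vec (length h) (\<lambda>i. jacobi_coeff N \<phi> (h ! i))"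

definition gram_mat ::
  "(complex \<times> complex) set \<Rightarrow> int \<Rightarrow> nat \<Rightarrow> (int \<times> int) list \<Rightarrow> complex mat"
  where "gram_mat F k N h =
    mat (length h) (length h) (\<lambda>(i, j). jacobi_coeff N (poincare F k N (h ! i)) (h ! j))"

end

(*
  The Petersson product is a positive definite hermitian form on the cusp forms, so Riesz
  representation in the finite-dimensional span of the P_h(i) gives <phi|P_a> = C_phi(a). Hence
  Gamma_h is the Gram matrix of the form in the basis P_h(i), gamma_h(phi) lists the products of phi
  with that basis, and the formula is the coordinate expression of the form.

  Convergence is the analytic point, since F is an arbitrary measurable fundamental domain. The
  function |phi|^2 v^k exp(-4 pi N y^2/v) and the measure v^-3 du dv dx dy are invariant under the
  Jacobi group. As the translates of F overlap in null sets, the integral over F is at most the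
  integral over any set whose translates cover everything. A Siegel set, reached by Dirichlet
  approximation, has finite measure, and there the Fourier expansion bounds the function.
  Definiteness follows from the same invariance together with continuity of phi.
*)
theory Submission
  imports Defs "Jordan_Normal_Form.Determinant"
begin

section \<open>Definite hermitian forms and Gram matrices\<close>

text \<open>Three definitions have a default value that must be ruled out before the algebra can
  start. \<open>jacobi_coeff\<close> and \<open>poincare\<close> are definite descriptions, and the
  Lebesgue integral in \<open>petersson\<close> is 0 when it diverges. Uniqueness of the Fourier
  expansion settles the first and makes C_\<phi>(a) linear in \<phi>. Integrability settles the last
  and makes the form additive.

  There is no circle in using the P_h(i) to obtain P_a. By hypothesis the values of
  \<open>poincare\<close> on \<open>h\<close> form a basis of the space, whatever functions they
  are. Riesz representation in that basis then shows that each description denotes, and this gives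
  the reproducing property, also for the basis elements themselves.

  The Siegel set is so crude because it serves only as a covering set of finite measure to compare
  with F. Overlaps among its translates merely enlarge the bound.\<close>

lemma mat_inverse_of_trivial_kernel:
  fixes A :: "'a :: field mat"
  assumes A: "A \<in> carrier_mat n n"
    and ker: "\<And>v. v \<in> carrier_vec n \<Longrightarrow> A *\<^sub>v v = 0\<^sub>v n \<Longrightarrow> v = 0\<^sub>v n"
  obtains H where "mat_inverse A = Some H" "H \<in> carrier_mat n n" "A * H = 1\<^sub>m n" "H * A = 1\<^sub>m n"
proof -
  have "Determinant.det A \<noteq> 0"
    using det_0_iff_vec_prod_zero_field [OF A] ker by auto
  then have "A \<in> Units (ring_mat TYPE('a) n ())"
    by (rule det_non_zero_imp_unit [OF A])
  with mat_inverse(1) [OF A] obtain H where "mat_inverse A = Some H" by fastforce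
  with mat_inverse(2) [OF A this] that show thesis by blast
qed

text \<open>The basis is a list because matrix entries are indexed by position. Every law of the
  form is restricted to \<open>V\<close>, since the Petersson integral is known to converge only for
  cusp forms. Of positivity only anisotropy is recorded, which is what makes the Gram matrix
  nonsingular.\<close>

locale definite_hermitian_form =
  fixes bs :: "('p \<Rightarrow> complex) list"
    and B :: "('p \<Rightarrow> complex) \<Rightarrow> ('p \<Rightarrow> complex) \<Rightarrow> complex"
    and V :: "('p \<Rightarrow> complex) set"
  assumes distinct: "distinct bs"
    and independent: "cfun.independent (set bs)"
    and span: "cfun.span (set bs) = V"
    and form_add: "\<And>x y z. x \<in> V \<Longrightarrow> y \<in> V \<Longrightarrow> z \<in> V \<Longrightarrow> B (x + y) z = B x z + B y z"
    and form_scale: "\<And>c x z. x \<in> V \<Longrightarrow> z \<in> V \<Longrightarrow> B (fun_scale c x) z = c * B x z"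
    and form_cnj: "\<And>x y. x \<in> V \<Longrightarrow> y \<in> V \<Longrightarrow> B y x = cnj (B x y)"
    and form_definite: "\<And>x. x \<in> V \<Longrightarrow> B x x = 0 \<Longrightarrow> x = 0"
begin

abbreviation n :: nat where "n \<equiv> length bs"

definition lincomb :: "(nat \<Rightarrow> complex) \<Rightarrow> 'p \<Rightarrow> complex"
  where "lincomb c = (\<Sum>i<n. fun_scale (c i) (bs ! i))"

definition gram :: "complex mat"
  where "gram = mat n n (\<lambda>(i, j). B (bs ! i) (bs ! j))"

lemma gram_carrier: "gram \<in> carrier_mat n n"
  by (simp add: gram_def)

lemma nth_in_V: "i < n \<Longrightarrow> bs ! i \<in> V"
  unfolding span [symmetric] by (simp add: cfun.span_base)

lemma subspace_V: "cfun.subspace V"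
  unfolding span [symmetric] by (rule cfun.subspace_span)

lemma bij_nth: "bij_betw ((!) bs) {..<n} (set bs)"
  using distinct by (simp add: bij_betw_nth)

lemma lincomb_in_V: "lincomb c \<in> V"
  unfolding lincomb_def
  by (intro cfun.subspace_sum subspace_V cfun.subspace_scale [OF subspace_V] nth_in_V) simp

lemma V_lincomb:
  assumes "x \<in> V"
  obtains c where "x = lincomb c"
proof -
  obtain u where "x = (\<Sum>v\<in>set bs. fun_scale (u v) v)"
    using assms unfolding span [symmetric] cfun.span_finite [OF finite_set] by auto
  also have "\<dots> = lincomb (\<lambda>i. u (bs ! i))"
    unfolding lincomb_def by (rule sum.reindex_bij_betw [OF bij_nth, symmetric])
  finally show thesis by (rule that)
qed

lemma lincomb_eq_0:
  assumes "lincomb c = 0" "i < n"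
  shows "c i = 0"
proof -
  \<comment> \<open>Independence speaks of coefficient functions on the set of vectors. Distinctness
    allows the coefficients indexed by position to be carried over to it.\<close>
  define u where "u = (\<lambda>v. c (the_inv_into {..<n} ((!) bs) v))"
  have inv: "u (bs ! j) = c j" if "j < n" for j
    unfolding u_def using the_inv_into_f_f [of "(!) bs" "{..<n}" j] bij_nth that
    by (simp add: bij_betw_def)
  have "(\<Sum>v\<in>set bs. fun_scale (u v) v) = (\<Sum>j<n. fun_scale (u (bs ! j)) (bs ! j))"
    by (rule sum.reindex_bij_betw [OF bij_nth, symmetric])
  also have "\<dots> = lincomb c"
    unfolding lincomb_def by (rule sum.cong) (simp_all add: inv)
  finally have "(\<Sum>v\<in>set bs. fun_scale (u v) v) = 0" using assms(1) by simp
  then have "u (bs ! i) = 0"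
    using independent assms(2) unfolding cfun.independent_explicit_finite_subsets
    by (meson finite_set nth_mem subset_refl)
  then show ?thesis using inv assms(2) by simp
qed

text \<open>\<open>L\<close> is linear on \<open>V\<close> only, so the induction carries membership
  of the partial sums along with their value.\<close>

lemma linear_on_lincomb:
  assumes add: "\<And>x y. x \<in> V \<Longrightarrow> y \<in> V \<Longrightarrow> L (x + y) = L x + L y"
    and scale: "\<And>c x. x \<in> V \<Longrightarrow> L (fun_scale c x) = c * (L x :: complex)"
  shows "L (lincomb c) = (\<Sum>i<n. c i * L (bs ! i))"
proof -
  have L0: "L 0 = 0"
    using scale [of 0 0] cfun.subspace_0 [OF subspace_V] by simp
  have "m \<le> n \<Longrightarrow> (\<Sum>i<m. fun_scale (c i) (bs ! i)) \<in> V \<and>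
      L (\<Sum>i<m. fun_scale (c i) (bs ! i)) = (\<Sum>i<m. c i * L (bs ! i))" for m
  proof (induction m)
    case 0
    show ?case
      unfolding lessThan_0 sum.empty using L0 cfun.subspace_0 [OF subspace_V] by blast
  next
    case (Suc m)
    let ?S = "\<Sum>i<m. fun_scale (c i) (bs ! i)"
    have S: "?S \<in> V" "L ?S = (\<Sum>i<m. c i * L (bs ! i))" using Suc by auto
    have m: "bs ! m \<in> V" using Suc nth_in_V by simp
    then have fm: "fun_scale (c m) (bs ! m) \<in> V"
      by (rule cfun.subspace_scale [OF subspace_V])
    show ?case
      unfolding sum.lessThan_Suc add [OF S(1) fm] scale [OF m] S(2)
      using cfun.subspace_add [OF subspace_V S(1) fm] by blast
  qed
  from this [of n] show ?thesis by (simp add: lincomb_def)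
qed

lemma form_lincomb_left:
  "y \<in> V \<Longrightarrow> B (lincomb c) y = (\<Sum>i<n. c i * B (bs ! i) y)"
  by (intro linear_on_lincomb form_add form_scale)

lemma form_lincomb_right:
  assumes "x \<in> V"
  shows "B x (lincomb c) = (\<Sum>i<n. cnj (c i) * B x (bs ! i))"
proof -
  have "B x (lincomb c) = cnj (B (lincomb c) x)"
    using form_cnj [OF lincomb_in_V assms] .
  also have "\<dots> = (\<Sum>i<n. cnj (c i) * cnj (B (bs ! i) x))"
    by (simp add: form_lincomb_left assms)
  also have "\<dots> = (\<Sum>i<n. cnj (c i) * B x (bs ! i))"
    by (rule sum.cong) (simp_all add: form_cnj [OF nth_in_V assms, symmetric])
  finally show ?thesis .
qed

text \<open>The form is conjugate linear in its second argument, so a column vector acts through the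
  combination with the conjugated entries.\<close>

lemma gram_mult_vec:
  assumes "v \<in> carrier_vec n" "i < n"
  shows "vec_index (gram *\<^sub>v v) i = B (bs ! i) (lincomb (\<lambda>j. cnj (vec_index v j)))"
  using assms
  by (simp add: gram_def form_lincomb_right nth_in_V scalar_prod_def mult.commute atLeast0LessThan)

text \<open>A kernel vector yields a combination \<open>?y\<close> orthogonal to every basis vector,
  hence to itself. Definiteness makes it 0, and independence makes its coordinates 0.\<close>

lemma gram_inverse:
  obtains H where "mat_inverse gram = Some H" "H \<in> carrier_mat n n"
    "gram * H = 1\<^sub>m n" "H * gram = 1\<^sub>m n"
proof (rule mat_inverse_of_trivial_kernel [OF gram_carrier])
  fix v :: "complex vec"
  assume v: "v \<in> carrier_vec n" and eq: "gram *\<^sub>v v = 0\<^sub>v n"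
  let ?y = "lincomb (\<lambda>j. cnj (vec_index v j))"
  have "B (bs ! i) ?y = 0" if "i < n" for i
    using gram_mult_vec [OF v that] that by (simp add: eq)
  then have "B ?y ?y = 0"
    by (subst form_lincomb_left) (simp_all add: lincomb_in_V)
  then have "?y = 0" by (rule form_definite [OF lincomb_in_V])
  from lincomb_eq_0 [OF this] show "v = 0\<^sub>v n"
    using v by (intro eq_vecI) auto
qed

text \<open>On the basis the condition is the linear system with matrix \<open>gram\<close> and
  right-hand side \<open>w\<close>, the values of \<open>L\<close>. The coordinates of P are the
  conjugates of its solution.\<close>

lemma riesz_representation:
  assumes add: "\<And>x y. x \<in> V \<Longrightarrow> y \<in> V \<Longrightarrow> L (x + y) = L x + L y"
    and scale: "\<And>c x. x \<in> V \<Longrightarrow> L (fun_scale c x) = c * (L x :: complex)"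
  shows "\<exists>!P. P \<in> V \<and> (\<forall>x\<in>V. B x P = L x)"
proof (rule ex_ex1I)
  obtain H where H: "H \<in> carrier_mat n n" "gram * H = 1\<^sub>m n"
    by (rule gram_inverse)
  define w where "w = vec n (\<lambda>i. L (bs ! i))"
  define v where "v = H *\<^sub>v w"
  have w: "w \<in> carrier_vec n" by (simp add: w_def)
  have v: "v \<in> carrier_vec n" unfolding v_def using H w by simp
  have "gram *\<^sub>v v = w"
    unfolding v_def using assoc_mult_mat_vec [OF gram_carrier H(1) w] H(2) w by simp
  then have gen: "B (bs ! i) (lincomb (\<lambda>j. cnj (vec_index v j))) = L (bs ! i)" if "i < n" for i
    using gram_mult_vec [OF v that] that by (simp add: w_def)
  have "B x (lincomb (\<lambda>j. cnj (vec_index v j))) = L x" if x: "x \<in> V" for x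
  proof -
    obtain c where c: "x = lincomb c" using x by (rule V_lincomb)
    have "L x = (\<Sum>i<n. c i * L (bs ! i))"
      unfolding c by (rule linear_on_lincomb [OF add scale])
    then show ?thesis
      unfolding c by (simp add: form_lincomb_left lincomb_in_V gen)
  qed
  then show "\<exists>P. P \<in> V \<and> (\<forall>x\<in>V. B x P = L x)"
    using lincomb_in_V by blast
next
  fix P Q
  assume P: "P \<in> V \<and> (\<forall>x\<in>V. B x P = L x)" and Q: "Q \<in> V \<and> (\<forall>x\<in>V. B x Q = L x)"
  \<comment> \<open>Since P and Q both represent \<open>L\<close>, both B P d and B Q d equal the
    conjugate of L d. Hence B d d = 0.\<close>
  define d where "d = P + fun_scale (- 1) Q"
  have dV: "d \<in> V"
    unfolding d_def using P Q cfun.subspace_add [OF subspace_V] cfun.subspace_scale [OF subspace_V] by blast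
  have "B d d = B (P + fun_scale (- 1) Q) d" by (simp only: d_def)
  also have "\<dots> = B P d + B (fun_scale (- 1) Q) d"
    using P Q dV by (intro form_add cfun.subspace_scale [OF subspace_V]) auto
  also have "B (fun_scale (- 1) Q) d = - 1 * B Q d"
    using Q dV by (intro form_scale) auto
  finally have "B d d = B P d + - 1 * B Q d" .
  moreover have "B P d = cnj (L d)" "B Q d = cnj (L d)"
    using P Q dV form_cnj [of d P] form_cnj [of d Q] by auto
  ultimately have "d = 0" by (intro form_definite [OF dV]) simp
  then show "P = Q" by (auto simp: d_def fun_scale_def fun_eq_iff)
qed

text \<open>By hermitian symmetry the conjugated products of \<open>y\<close> with the basis are the
  vector \<open>gram\<close> times \<open>e\<close>, where \<open>e\<close> holds the conjugated
  coordinates of \<open>y\<close>. So \<open>H\<close> returns \<open>e\<close>, and pairing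
  \<open>e\<close> with the products of \<open>x\<close> is the expansion of B x y in its second
  argument.\<close>

lemma form_eq_gram_inverse:
  assumes x: "x \<in> V" and y: "y \<in> V" and H: "H \<in> carrier_mat n n" "H * gram = 1\<^sub>m n"
  shows "B x y = scalar_prod (vec n (\<lambda>i. B x (bs ! i)))
    (H *\<^sub>v map_vec cnj (vec n (\<lambda>i. B y (bs ! i))))"
proof -
  obtain d where d: "y = lincomb d" using y by (rule V_lincomb)
  define e where "e = vec n (\<lambda>i. cnj (d i))"
  have e: "e \<in> carrier_vec n" by (simp add: e_def)
  have de: "lincomb (\<lambda>j. cnj (vec_index e j)) = y"
    unfolding d lincomb_def by (rule sum.cong) (simp_all add: e_def)
  have "map_vec cnj (vec n (\<lambda>i. B y (bs ! i))) = gram *\<^sub>v e"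
  proof (rule eq_vecI)
    fix i assume "i < dim_vec (gram *\<^sub>v e)"
    then have i: "i < n" by (simp add: gram_def)
    show "vec_index (map_vec cnj (vec n (\<lambda>i. B y (bs ! i)))) i = vec_index (gram *\<^sub>v e) i"
      using i gram_mult_vec [OF e i] form_cnj [OF y nth_in_V [OF i]] by (simp add: de)
  qed (simp add: gram_def)
  then have "H *\<^sub>v map_vec cnj (vec n (\<lambda>i. B y (bs ! i))) = e"
    using assoc_mult_mat_vec [OF H(1) gram_carrier e] H(2) e by simp
  then show ?thesis
    using form_lincomb_right [OF x, of d]
    by (simp add: d [symmetric] e_def scalar_prod_def mult.commute atLeast0LessThan)
qed

end

section \<open>Uniqueness of Fourier-Jacobi coefficients\<close>

lemma sum_root_of_unity_powers_eq_0:
  assumes "M > 0" "\<not> int M dvd n"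
  shows "(\<Sum>j<M. exp (2 * of_real pi * \<i> * (of_int n * of_nat j / of_nat M))) = 0"
proof -
  define w where "w = exp (2 * of_real pi * \<i> * (of_int n / of_nat M))"
  have pw: "exp (2 * of_real pi * \<i> * (of_int n * of_nat j / of_nat M)) = w ^ j" for j
    unfolding w_def exp_of_nat_mult [symmetric] by (simp add: field_simps)
  have "w ^ M = exp (of_int n * (2 * of_real pi * \<i>))"
    unfolding w_def exp_of_nat_mult [symmetric] using assms by (simp add: field_simps)
  then have wM: "w ^ M = 1"
    using exp_integer_2pi [of "of_int n"] by (simp add: mult_ac)
  have "w \<noteq> 1"
  proof
    assume "w = 1"
    then obtain k :: int where k: "Im (2 * of_real pi * \<i> * (of_int n / of_nat M)) = of_int (2 * k) * pi"
      unfolding w_def exp_eq_1 by auto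
    have "Im (2 * of_real pi * \<i> * (of_int n / of_nat M)) = 2 * pi * (of_int n / of_nat M)"
      by (simp add: Im_divide_of_nat)
    with k have "2 * pi * (of_int n / of_nat M) = 2 * pi * (of_int k :: real)" by (simp only:) simp
    then have "of_int n / of_nat M = (of_int k :: real)"
      by (simp only: mult_cancel_left) simp
    then have "(of_int n :: real) = of_int (k * int M)"
      using assms(1) by (simp add: field_simps)
    then have "n = k * int M" by (simp only: of_int_eq_iff)
    with assms(2) show False by simp
  qed
  then show ?thesis
    unfolding pw using wM by (simp add: geometric_sum)
qed

lemma has_sum_finite_sum:
  fixes f :: "'b \<Rightarrow> 'a \<Rightarrow> 'c :: topological_comm_monoid_add"
  assumes "finite I" "\<And>i. i \<in> I \<Longrightarrow> (f i has_sum s i) A"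
  shows "((\<lambda>a. \<Sum>i\<in>I. f i a) has_sum (\<Sum>i\<in>I. s i)) A"
  using assms by (induction I rule: finite_induct) (auto intro: has_sum_add)

text \<open>This is orthogonality of characters with the integral over the torus replaced by an
  average over a finite grid, so that only finite sums are interchanged with the infinite one. The
  average isolates the coefficient up to a tail, and the tail is chosen smaller than the coefficient
  if the latter is nonzero.\<close>

lemma Fourier_coefficients_eq_0:
  fixes E :: "int \<times> int \<Rightarrow> complex"
  assumes sum0: "\<And>u x :: real. ((\<lambda>(n, r). E (n, r) * exp (2 * of_real pi * \<i> * (of_int n * of_real u + of_int r * of_real x))) has_sum 0) A"
    and a: "(n0, r0) \<in> A"
  shows "E (n0, r0) = 0"
proof (rule ccontr)
  assume ne: "E (n0, r0) \<noteq> 0"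
  define e :: "real \<Rightarrow> complex" where "e = (\<lambda>t. exp (2 * of_real pi * \<i> * of_real t))"
  have norm_e [simp]: "cmod (e t) = 1" for t
    by (simp add: e_def)
  have e_add: "e (s + t) = e s * e t" for s t
    by (simp add: e_def exp_add [symmetric] distrib_left)
  have s0: "((\<lambda>(n, r). E (n, r) * e (of_int n * u + of_int r * x)) has_sum 0) A" for u x
    using sum0 [of u x] by (simp add: e_def case_prod_unfold)
  define F where "F = (\<lambda>a. cmod (E a))"
  \<comment> \<open>At u = x = 0 every exponential is 1. For complex terms unordered summability is
    absolute, which gives the tail estimate.\<close>
  have "E summable_on A"
    using has_sum_imp_summable [OF s0 [of 0 0]] by (simp add: e_def)
  then have Fs: "F summable_on A" unfolding F_def
    by (simp add: summable_on_iff_abs_summable_on_complex)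
  obtain X where X: "finite X" "X \<subseteq> A" "infsum F (A - X) < cmod (E (n0, r0))"
  proof -
    have "(F has_sum infsum F A) A" using Fs by (rule has_sum_infsum)
    then have "((\<lambda>X. sum F X) \<longlongrightarrow> infsum F A) (finite_subsets_at_top A)"
      by (simp add: has_sum_def)
    then have "\<forall>\<^sub>F X in finite_subsets_at_top A. dist (sum F X) (infsum F A) < cmod (E (n0, r0))"
      by (rule tendstoD) (use ne in simp)
    then obtain X where X: "finite X" "X \<subseteq> A" "dist (sum F X) (infsum F A) < cmod (E (n0, r0))"
      unfolding eventually_finite_subsets_at_top by blast
    have "infsum F (A - X) = infsum F A - sum F X"
      using infsum_Diff [OF Fs _ X(2)] X(1) by (simp add: summable_on_finite)
    with X show ?thesis by (intro that [of X]) (auto simp: dist_real_def)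
  qed
  \<comment> \<open>The modulus exceeds every frequency difference occurring in \<open>X\<close>, so
    it divides such a difference only if the difference is 0.\<close>
  define m where "m = 1 + (\<Sum>(n, r)\<in>X. \<bar>n - n0\<bar> + \<bar>r - r0\<bar>)"
  define M where "M = nat m"
  have m1: "m \<ge> 1" unfolding m_def by (auto intro!: sum_nonneg)
  then have M0: "M > 0" and intM: "int M = m" by (auto simp: M_def)
  have small: "\<bar>n - n0\<bar> < m \<and> \<bar>r - r0\<bar> < m" if "(n, r) \<in> X" for n r
  proof -
    have "\<bar>n - n0\<bar> + \<bar>r - r0\<bar> \<le> (\<Sum>(n, r)\<in>X. \<bar>n - n0\<bar> + \<bar>r - r0\<bar>)"
      using member_le_sum [of "(n, r)" X "\<lambda>(n, r). \<bar>n - n0\<bar> + \<bar>r - r0\<bar>"] that X(1) by auto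
    then show ?thesis unfolding m_def by linarith
  qed
  text \<open>Averaging over \<open>M\<close>-th roots of unity in both variables kills every frequency of \<open>X\<close>
    other than \<open>(n0, r0)\<close>, and the frequencies outside \<open>X\<close> contribute too little.\<close>
  define avg where "avg = (\<lambda>(n::int, r::int). (\<Sum>(j, l)\<in>{..<M} \<times> {..<M}.
      e (of_int (n - n0) * (real j / real M) + of_int (r - r0) * (real l / real M))) / of_nat (M * M))"
  have avg_prod: "avg (n, r) = (\<Sum>j<M. e (of_int (n - n0) * (real j / real M))) *
      (\<Sum>l<M. e (of_int (r - r0) * (real l / real M))) / of_nat (M * M)" for n r
    unfolding avg_def by (simp add: e_add sum_product sum.cartesian_product)
  have avg1: "avg (n0, r0) = 1"
    unfolding avg_prod using M0 by (simp add: e_def)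
  have avg0: "avg (n, r) = 0" if "(n, r) \<in> X" "(n, r) \<noteq> (n0, r0)" for n r
  proof -
    have "n \<noteq> n0 \<or> r \<noteq> r0" using that by auto
    then have "\<not> int M dvd (n - n0) \<or> \<not> int M dvd (r - r0)"
      using small [OF that(1)] zdvd_not_zless [of "\<bar>n - n0\<bar>" "int M"]
        zdvd_not_zless [of "\<bar>r - r0\<bar>" "int M"] unfolding intM by auto
    then have "(\<Sum>j<M. e (of_int (n - n0) * (real j / real M))) = 0 \<or>
      (\<Sum>l<M. e (of_int (r - r0) * (real l / real M))) = 0"
      using sum_root_of_unity_powers_eq_0 [OF M0, of "n - n0"] sum_root_of_unity_powers_eq_0 [OF M0, of "r - r0"]
      by (auto simp: e_def)
    then show ?thesis unfolding avg_prod by auto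
  qed
  have avg_le: "cmod (avg a) \<le> 1" for a
  proof -
    obtain n r where a: "a = (n, r)" by fastforce
    have "cmod (\<Sum>(j, l)\<in>{..<M} \<times> {..<M}.
      e (of_int (n - n0) * (real j / real M) + of_int (r - r0) * (real l / real M)))
      \<le> real (card ({..<M} \<times> {..<M})) * 1"
      by (rule sum_norm_bound) auto
    then show ?thesis
      using M0 by (simp add: a avg_def norm_divide field_simps norm_mult)
  qed
  define P where "P = {..<M} \<times> {..<M}"
  \<comment> \<open>The vanishing series at the grid point \<open>jl\<close>, multiplied by the
    inverse of the character with frequency (n0, r0).\<close>
  define G where "G = (\<lambda>jl a. (case a of (n, r) \<Rightarrow>
        E (n, r) * e (of_int n * (real (fst jl) / real M) + of_int r * (real (snd jl) / real M)))
      * e (- of_int n0 * (real (fst jl) / real M) - of_int r0 * (real (snd jl) / real M)))"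
  have "(G jl has_sum 0) A" for jl
    using has_sum_cmult_left [OF s0 [of "real (fst jl) / real M" "real (snd jl) / real M"],
        of "e (- of_int n0 * (real (fst jl) / real M) - of_int r0 * (real (snd jl) / real M))"]
    unfolding G_def by simp
  then have "((\<lambda>a. \<Sum>jl\<in>P. G jl a) has_sum (\<Sum>jl\<in>P. 0)) A"
    by (intro has_sum_finite_sum) (auto simp: P_def)
  then have "((\<lambda>a. (\<Sum>jl\<in>P. G jl a) * (1 / of_nat (M * M))) has_sum (\<Sum>jl\<in>P. 0) * (1 / of_nat (M * M))) A"
    by (rule has_sum_cmult_left)
  also have "(\<lambda>a. (\<Sum>jl\<in>P. G jl a) * (1 / of_nat (M * M))) = (\<lambda>a. E a * avg a)"
  proof
    fix a :: "int \<times> int"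
    obtain n r where a: "a = (n, r)" by fastforce
    have "G jl a = E a * e (of_int (n - n0) * (real (fst jl) / real M) + of_int (r - r0) * (real (snd jl) / real M))" for jl
      unfolding G_def a by (simp add: mult.assoc e_add [symmetric]) (simp add: algebra_simps diff_divide_distrib)
    then have "(\<Sum>jl\<in>P. G jl a) = E a * (\<Sum>jl\<in>P.
        e (of_int (n - n0) * (real (fst jl) / real M) + of_int (r - r0) * (real (snd jl) / real M)))"
      by (simp add: sum_distrib_left)
    then show "(\<Sum>jl\<in>P. G jl a) * (1 / of_nat (M * M)) = E a * avg a"
      by (simp add: a avg_def P_def case_prod_unfold)
  qed
  finally have tot: "((\<lambda>a. E a * avg a) has_sum 0) A" by simp
  have a0X: "(n0, r0) \<in> X"
  proof (rule ccontr)
    assume n: "(n0, r0) \<notin> X"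
    have "sum F {(n0, r0)} \<le> infsum F (A - X)"
      by (rule finite_sum_le_infsum)
        (use n a Fs X in \<open>auto simp: F_def intro: summable_on_subset_banach\<close>)
    with X show False by (simp add: F_def)
  qed
  have "((\<lambda>a. E a * avg a) has_sum (\<Sum>a\<in>X. E a * avg a)) X"
    using X(1) by (rule has_sum_finite)
  moreover have "(\<Sum>a\<in>X. E a * avg a) = E (n0, r0) * avg (n0, r0)"
    by (subst sum.remove [OF X(1) a0X], subst sum.neutral) (use avg0 in auto)
  ultimately have "((\<lambda>a. E a * avg a) has_sum E (n0, r0)) X"
    using avg1 by simp
  from has_sum_Diff [OF tot this X(2)]
  have rest: "((\<lambda>a. E a * avg a) has_sum - E (n0, r0)) (A - X)" by simp
  have "cmod (- E (n0, r0)) \<le> infsum F (A - X)"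
  proof (rule norm_infsum_le [OF rest])
    show "(F has_sum infsum F (A - X)) (A - X)"
      by (rule has_sum_infsum) (use Fs in \<open>auto intro: summable_on_subset_banach\<close>)
    show "cmod (E a * avg a) \<le> F a" if "a \<in> A - X" for a
      using avg_le [of a] by (simp add: F_def norm_mult mult_left_le)
  qed
  with X(3) show False by simp
qed

text \<open>On the line Im \<tau> = 1 with real z the two expansions become trigonometric series in
  (Re \<tau>, z) with the same sum. Their difference vanishes, and its coefficients are the
  differences C - C' times the nonzero factors exp(-2 pi n). Outside \<open>admissible N\<close>
  both coefficient functions are 0 by normalisation.\<close>

lemma has_jacobi_expansion_unique:
  assumes N: "N \<ge> 1" and C: "has_jacobi_expansion N \<phi> C" and C': "has_jacobi_expansion N \<phi> C'"
  shows "C = C'"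
proof
  fix a :: "int \<times> int"
  show "C a = C' a"
  proof (cases "a \<in> admissible N")
    case False
    then have "C a = 0" "C' a = 0" using C C' unfolding has_jacobi_expansion_def by blast+
    then show ?thesis by simp
  next
    case True
    \<comment> \<open>Passage from (D, r) to the integral frequencies (n, r) of \<tau> and z. The
      congruence defining admissibility makes the division exact and the map injective.\<close>
    define ix where "ix = (\<lambda>(D::int, r::int). ((r\<^sup>2 - D) div (4 * int N), r))"
    have ixN: "r\<^sup>2 - D = 4 * int N * fst (ix (D, r))" if "(D, r) \<in> admissible N" for D r
      using that by (auto simp: admissible_def ix_def cong_iff_dvd_diff dvd_diff_commute)
    have inj: "inj_on ix (admissible N)"
    proof (rule inj_onI)
      fix p q assume pq: "p \<in> admissible N" "q \<in> admissible N" "ix p = ix q"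
      obtain D r D' r' where [simp]: "p = (D, r)" "q = (D', r')" by (metis surj_pair)
      have "r = r'" using pq(3) by (simp add: ix_def)
      then show "p = q" using pq ixN [of D r] ixN [of D' r'] by auto
    qed
    define iv where "iv = inv_into (admissible N) ix"
    have iv: "iv (ix p) = p" if "p \<in> admissible N" for p
      unfolding iv_def using inj that by (rule inv_into_f_f)
    define E where "E = (\<lambda>nr. (C (iv nr) - C' (iv nr)) * exp (- 2 * of_real pi * of_int (fst nr)))"
    have "((\<lambda>(n, r). E (n, r) * exp (2 * of_real pi * \<i> * (of_int n * of_real u + of_int r * of_real x))) has_sum 0) (ix ` admissible N)" for u x :: real
    proof -
      let ?t = "Complex u 1"
      let ?e = "\<lambda>p. exp (2 * of_real pi * \<i> * (of_int ((snd p)\<^sup>2 - fst p) / of_nat (4 * N) * ?t + of_int (snd p) * of_real x))"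
      have "((\<lambda>p. C p * ?e p) has_sum \<phi> (?t, of_real x)) (admissible N)"
        using C unfolding has_jacobi_expansion_def case_prod_unfold by simp
      moreover have "((\<lambda>p. C' p * ?e p) has_sum \<phi> (?t, of_real x)) (admissible N)"
        using C' unfolding has_jacobi_expansion_def case_prod_unfold by simp
      ultimately have "((\<lambda>p. C p * ?e p - C' p * ?e p) has_sum (\<phi> (?t, of_real x) - \<phi> (?t, of_real x))) (admissible N)"
        unfolding diff_conv_add_uminus by (intro has_sum_add has_sum_uminus [THEN iffD2]) simp_all
      then have d: "((\<lambda>p. (C p - C' p) * ?e p) has_sum 0) (admissible N)"
        by (simp add: algebra_simps)
      have ee: "?e p = exp (- 2 * of_real pi * of_int (fst (ix p))) *
          exp (2 * of_real pi * \<i> * (of_int (fst (ix p)) * of_real u + of_int (snd (ix p)) * of_real x))"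
        if "p \<in> admissible N" for p
      proof -
        obtain D r where p: "p = (D, r)" by (metis surj_pair)
        have "of_int ((snd p)\<^sup>2 - fst p) / of_nat (4 * N) = (of_int (fst (ix p)) :: complex)"
          using ixN [of D r] that N unfolding p by (simp add: field_simps)
        moreover have "snd (ix p) = snd p" by (simp add: ix_def p)
        moreover have "?t = of_real u + \<i>" by (simp add: complex_eq_iff)
        ultimately show ?thesis
          by (simp only:) (simp add: exp_add [symmetric] algebra_simps)
      qed
      show ?thesis
      proof (subst has_sum_reindex [OF inj], rule has_sum_cong [THEN iffD1, OF _ d])
        fix p assume p: "p \<in> admissible N"
        show "(C p - C' p) * ?e p = ((\<lambda>(n, r). E (n, r) * exp (2 * of_real pi * \<i> * (of_int n * of_real u + of_int r * of_real x))) \<circ> ix) p"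
          unfolding ee [OF p] by (simp add: E_def case_prod_unfold iv [OF p] mult.assoc)
      qed
    qed
    from Fourier_coefficients_eq_0 [OF this, of "fst (ix a)" "snd (ix a)"] True
    show ?thesis by (simp add: E_def iv)
  qed
qed

section \<open>Linearity of the coefficient functionals\<close>

lemma jacobi_coeff_eqI: "N \<ge> 1 \<Longrightarrow> has_jacobi_expansion N \<phi> C \<Longrightarrow> jacobi_coeff N \<phi> = C"
  unfolding jacobi_coeff_def by (blast intro: the_equality has_jacobi_expansion_unique)

lemma has_jacobi_expansion_jacobi_coeff:
  "N \<ge> 1 \<Longrightarrow> \<phi> \<in> jacobi_cusp_forms k N \<Longrightarrow> has_jacobi_expansion N \<phi> (jacobi_coeff N \<phi>)"
  unfolding jacobi_cusp_forms_def using jacobi_coeff_eqI by fastforce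

lemma jacobi_coeff_add:
  assumes "N \<ge> 1" "\<phi> \<in> jacobi_cusp_forms k N" "\<psi> \<in> jacobi_cusp_forms k N"
  shows "jacobi_coeff N (\<phi> + \<psi>) a = jacobi_coeff N \<phi> a + jacobi_coeff N \<psi> a"
proof -
  have "has_jacobi_expansion N (\<phi> + \<psi>) (\<lambda>a. jacobi_coeff N \<phi> a + jacobi_coeff N \<psi> a)"
    using has_jacobi_expansion_jacobi_coeff [OF assms(1,2)] has_jacobi_expansion_jacobi_coeff [OF assms(1,3)]
    unfolding has_jacobi_expansion_def case_prod_unfold
    by (auto simp: distrib_right intro!: has_sum_add)
  from jacobi_coeff_eqI [OF assms(1) this] show ?thesis by simp
qed

lemma jacobi_coeff_scale:
  assumes "N \<ge> 1" "\<phi> \<in> jacobi_cusp_forms k N"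
  shows "jacobi_coeff N (fun_scale c \<phi>) a = c * jacobi_coeff N \<phi> a"
proof -
  have "has_jacobi_expansion N (fun_scale c \<phi>) (\<lambda>a. c * jacobi_coeff N \<phi> a)"
    using has_jacobi_expansion_jacobi_coeff [OF assms]
    unfolding has_jacobi_expansion_def case_prod_unfold
    by (auto simp: mult.assoc fun_scale_def intro!: has_sum_cmult_right)
  from jacobi_coeff_eqI [OF assms(1) this] show ?thesis by simp
qed

section \<open>Change of variables in the complex plane\<close>

text \<open>The Jacobian theorem used below concerns maps of \<open>real ^ 'n\<close>, where the
  determinant of a matrix is available. These coordinates carry it to complex maps, and
  \<open>distr_complex_of_vec2\<close> shows that they preserve Lebesgue measure.\<close>

definition complex_of_vec2 :: "real ^ 2 \<Rightarrow> complex"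
  where "complex_of_vec2 x = Complex (vec_nth x 1) (vec_nth x 2)"

definition vec2_of_complex :: "complex \<Rightarrow> real ^ 2"
  where "vec2_of_complex z = vector [Re z, Im z]"

lemma vec2_of_complex_inverse [simp]: "complex_of_vec2 (vec2_of_complex z) = z"
  by (simp add: complex_of_vec2_def vec2_of_complex_def)

lemma complex_of_vec2_inverse [simp]: "vec2_of_complex (complex_of_vec2 x) = x"
  by (simp add: complex_of_vec2_def vec2_of_complex_def Finite_Cartesian_Product.vec_eq_iff forall_2)

lemma bounded_linear_complex_of_vec2: "bounded_linear complex_of_vec2"
  unfolding linear_conv_bounded_linear [symmetric]
  by (rule linearI) (simp_all add: complex_of_vec2_def complex_eq_iff)

lemma bounded_linear_vec2_of_complex: "bounded_linear vec2_of_complex"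
  unfolding linear_conv_bounded_linear [symmetric]
  by (rule linearI) (simp_all add: vec2_of_complex_def Finite_Cartesian_Product.vec_eq_iff forall_2)

lemma measurable_complex_of_vec2 [measurable]: "complex_of_vec2 \<in> borel_measurable borel"
  by (intro borel_measurable_continuous_onI linear_continuous_on bounded_linear_complex_of_vec2)

lemma Basis_vec2: "(Basis :: (real ^ 2) set) = {axis 1 1, axis 2 1}"
  by (auto simp: Basis_vec_def exhaust_2 UNIV_2)

lemma axis_12_neq: "axis 1 1 \<noteq> (axis 2 1 :: real ^ 2)"
  by (simp add: axis_eq_axis)

lemma distr_complex_of_vec2: "distr lborel borel complex_of_vec2 = lborel"
proof (rule lborel_eqI [symmetric])
  fix l u :: complex
  assume le: "\<And>b. b \<in> Basis \<Longrightarrow> l \<bullet> b \<le> u \<bullet> b"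
  have *: "complex_of_vec2 -` box l u = box (vec2_of_complex l) (vec2_of_complex u)"
    by (auto simp: complex_of_vec2_def vec2_of_complex_def mem_box_cart forall_2 in_box_complex_iff)
  have "Re l \<le> Re u" "Im l \<le> Im u"
    using le [of 1] le [of \<i>] by (auto simp: Basis_complex_def)
  then show "emeasure (distr lborel borel complex_of_vec2) (box l u)
      = ennreal (\<Prod>b\<in>Basis. (u - l) \<bullet> b)"
    by (simp add: emeasure_distr * emeasure_lborel_box_eq Basis_vec2 axis_12_neq inner_axis
        vec2_of_complex_def Basis_complex_def)
qed simp

text \<open>The Cauchy-Riemann form of the Jacobian: multiplication by a + bi has the real matrix
  with rows (a, -b) and (b, a).\<close>

lemma det_matrix_complex_mult:
  "Determinants.det (matrix (\<lambda>x. vec2_of_complex (w * complex_of_vec2 x))) = (cmod w)\<^sup>2"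
  unfolding cmod_power2
  by (simp add: det_2 matrix_def vec2_of_complex_def complex_of_vec2_def axis_def power2_eq_square)

text \<open>The Jacobian theorem is an equivalence: the Jacobian has integral r exactly if the image
  is measurable with finite measure r. If \<open>?I\<close> is finite, one direction applies. If it
  is infinite, the other direction excludes an image of finite measure.\<close>

lemma emeasure_lborel_complex_image:
  fixes f f' :: "complex \<Rightarrow> complex"
  assumes S [measurable]: "S \<in> sets borel"
    and fS [measurable]: "f ` S \<in> sets borel"
    and f': "\<And>x. x \<in> S \<Longrightarrow> (f has_field_derivative f' x) (at x)"
    and meas [measurable]: "f' \<in> borel_measurable borel"
    and inj: "inj_on f S"
  shows "emeasure lborel (f ` S) = (\<integral>\<^sup>+x. ennreal ((cmod (f' x))\<^sup>2) * indicator S x \<partial>lborel)"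
proof -
  define g where "g = (\<lambda>x. vec2_of_complex (f (complex_of_vec2 x)))"
  define g' where "g' = (\<lambda>x y. vec2_of_complex (f' (complex_of_vec2 x) * complex_of_vec2 y))"
  define T where "T = vec2_of_complex ` S"
  have T_eq: "T = complex_of_vec2 -` S"
    unfolding T_def by (auto simp: image_iff) (metis complex_of_vec2_inverse)
  have [measurable]: "T \<in> sets borel"
    unfolding T_eq using measurable_sets_borel [OF measurable_complex_of_vec2 S] by simp
  have gT: "g ` T = complex_of_vec2 -` (f ` S)"
    unfolding T_def g_def by (auto simp: image_iff) (metis complex_of_vec2_inverse)
  have [measurable]: "g ` T \<in> sets borel"
    unfolding gT using measurable_sets_borel [OF measurable_complex_of_vec2 fS] by simp
  have der: "(g has_derivative g' x) (at x within T)" if "x \<in> T" for x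
  proof -
    have "(f has_derivative (\<lambda>y. f' (complex_of_vec2 x) * y)) (at (complex_of_vec2 x))"
      using f' [of "complex_of_vec2 x"] that by (auto simp: T_eq has_field_derivative_def)
    from has_derivative_compose [OF bounded_linear.has_derivative [OF bounded_linear_complex_of_vec2 has_derivative_ident] this]
    have "((\<lambda>x. f (complex_of_vec2 x)) has_derivative
        (\<lambda>y. f' (complex_of_vec2 x) * complex_of_vec2 y)) (at x)"
      by simp
    from bounded_linear.has_derivative [OF bounded_linear_vec2_of_complex this]
    show ?thesis unfolding g_def g'_def by (rule has_derivative_at_withinI)
  qed
  have injg: "inj_on g T"
  proof (rule inj_onI)
    fix x y assume xy: "x \<in> T" "y \<in> T" "g x = g y"
    then have "f (complex_of_vec2 x) = f (complex_of_vec2 y)"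
      unfolding g_def by (metis vec2_of_complex_inverse)
    then have "complex_of_vec2 x = complex_of_vec2 y"
      using inj xy(1,2) by (auto simp: T_eq inj_on_def)
    then show "x = y" by (metis complex_of_vec2_inverse)
  qed
  have D: "\<bar>Determinants.det (matrix (g' x))\<bar> = (cmod (f' (complex_of_vec2 x)))\<^sup>2" for x
    unfolding g'_def by (simp add: det_matrix_complex_mult)
  note main = has_measure_differentiable_image [OF _ der injg]
  let ?I = "\<integral>\<^sup>+x. ennreal ((cmod (f' (complex_of_vec2 x)))\<^sup>2 * indicator T x) \<partial>lborel"
  have lhs: "emeasure lborel (f ` S) = emeasure lborel (g ` T)"
    unfolding gT by (subst distr_complex_of_vec2 [symmetric]) (simp add: emeasure_distr)
  have rhs: "(\<integral>\<^sup>+x. ennreal ((cmod (f' x))\<^sup>2) * indicator S x \<partial>lborel) = ?I"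
    by (subst distr_complex_of_vec2 [symmetric])
      (auto simp: nn_integral_distr T_eq indicator_def intro!: nn_integral_cong)
  have TL: "T \<in> sets lebesgue" by simp
  show ?thesis
  proof (cases "?I = \<infinity>")
    case False
    then obtain r where r: "?I = ennreal r" "r \<ge> 0"
      by (cases ?I) auto
    have "((\<lambda>x. (cmod (f' (complex_of_vec2 x)))\<^sup>2 * indicator T x) has_integral r) UNIV"
      by (rule nn_integral_has_integral [OF _ _ r]) auto
    then have "((\<lambda>x. (cmod (f' (complex_of_vec2 x)))\<^sup>2) has_integral r) T"
      by (subst has_integral_restrict_UNIV [symmetric], elim has_integral_eq [rotated])
        (auto simp: indicator_def)
    then have "g ` T \<in> lmeasurable \<and> measure lebesgue (g ` T) = r"
      using main [OF TL, of r] D by simp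
    then show ?thesis
      using lhs rhs r emeasure_eq_measure2 [of "g ` T" lebesgue] by simp
  next
    case True
    have "emeasure lborel (g ` T) = \<infinity>"
    proof (rule ccontr)
      assume "emeasure lborel (g ` T) \<noteq> \<infinity>"
      then have "g ` T \<in> lmeasurable"
        by (auto simp: fmeasurable_def less_top)
      then have "((\<lambda>x. (cmod (f' (complex_of_vec2 x)))\<^sup>2) has_integral measure lebesgue (g ` T)) T"
        using main [OF TL, of "measure lebesgue (g ` T)"] D by simp
      from nn_integral_has_integral_lebesgue [OF _ this] have "?I = ennreal (measure lebesgue (g ` T))"
        by (simp add: mult.commute)
      with True show False by simp
    qed
    with lhs rhs True show ?thesis by simp
  qed
qed

text \<open>Two measures are shown to be equal: the image under \<open>f\<close> of the Jacobian
  density on S, and Lebesgue measure on f(S). On a Borel set B this is the image formula for the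
  part of S mapped into B, which is why \<open>img\<close> concerns all Borel subsets of S.\<close>

lemma nn_integral_complex_substitution:
  fixes f f' :: "complex \<Rightarrow> complex"
  assumes [measurable]: "S \<in> sets borel" "f \<in> borel_measurable borel" "f' \<in> borel_measurable borel"
    "G \<in> borel_measurable borel"
    and img: "\<And>T. T \<in> sets borel \<Longrightarrow> T \<subseteq> S \<Longrightarrow> f ` T \<in> sets borel"
    and f': "\<And>x. x \<in> S \<Longrightarrow> (f has_field_derivative f' x) (at x)"
    and inj: "inj_on f S"
  shows "(\<integral>\<^sup>+x. G (f x) * ennreal ((cmod (f' x))\<^sup>2) * indicator S x \<partial>lborel)
    = (\<integral>\<^sup>+y. G y * indicator (f ` S) y \<partial>lborel)"
proof -
  have [measurable]: "f ` S \<in> sets borel" by (rule img) auto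
  let ?w = "\<lambda>x. ennreal ((cmod (f' x))\<^sup>2) * indicator S x"
  have eq: "distr (density lborel ?w) borel f = density lborel (indicator (f ` S))"
  proof (rule measure_eqI)
    fix B assume "B \<in> sets (distr (density lborel ?w) borel f)"
    then have B [measurable]: "B \<in> sets borel" by simp
    have fB: "f -` B \<in> sets borel" using measurable_sets_borel [OF assms(2) B] by simp
    then have T [measurable]: "S \<inter> f -` B \<in> sets borel" by simp
    have "emeasure (distr (density lborel ?w) borel f) B
        = (\<integral>\<^sup>+x. ?w x * indicator (f -` B) x \<partial>lborel)"
      using fB by (subst emeasure_distr) (auto simp: emeasure_density)
    also have "\<dots> = (\<integral>\<^sup>+x. ennreal ((cmod (f' x))\<^sup>2) * indicator (S \<inter> f -` B) x \<partial>lborel)"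
      by (intro nn_integral_cong) (auto simp: indicator_def)
    also have "\<dots> = emeasure lborel (f ` (S \<inter> f -` B))"
      by (rule emeasure_lborel_complex_image [symmetric])
        (use T img f' inj in \<open>auto simp: inj_on_def\<close>)
    also have "f ` (S \<inter> f -` B) = f ` S \<inter> B" by auto
    also have "emeasure lborel (f ` S \<inter> B) = emeasure (density lborel (indicator (f ` S))) B"
      by (simp add: emeasure_density nn_integral_indicator indicator_inter_arith [symmetric])
    finally show "emeasure (distr (density lborel ?w) borel f) B
        = emeasure (density lborel (indicator (f ` S))) B" .
  qed simp
  have "(\<integral>\<^sup>+x. G (f x) * ennreal ((cmod (f' x))\<^sup>2) * indicator S x \<partial>lborel)
      = (\<integral>\<^sup>+y. G y \<partial>distr (density lborel ?w) borel f)"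
    by (subst nn_integral_distr) (auto simp: nn_integral_density mult_ac)
  also have "\<dots> = (\<integral>\<^sup>+y. G y * indicator (f ` S) y \<partial>lborel)"
    unfolding eq by (simp add: nn_integral_density mult.commute)
  finally show ?thesis .
qed

lemma nn_integral_complex_affine:
  fixes a b :: complex
  assumes [measurable]: "G \<in> borel_measurable borel" and a: "a \<noteq> 0"
  shows "(\<integral>\<^sup>+x. G (a * x + b) \<partial>lborel) * ennreal ((cmod a)\<^sup>2) = (\<integral>\<^sup>+y. G y \<partial>lborel)"
proof -
  let ?f = "\<lambda>x. a * x + b"
  have im: "?f ` T = (\<lambda>y. (y - b) / a) -` T" for T
    using a by (auto simp: image_iff intro!: bexI [of _ "(_ - b) / a"])
  have m: "?f ` T \<in> sets borel" if "T \<in> sets borel" for T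
  proof -
    have "(\<lambda>y. (y - b) / a) \<in> borel_measurable borel" by measurable
    from measurable_sets_borel [OF this that] show ?thesis by (simp add: im)
  qed
  have "?f ` UNIV = UNIV" unfolding im by simp
  moreover have "(\<integral>\<^sup>+x. G (?f x) * ennreal ((cmod a)\<^sup>2) * indicator UNIV x \<partial>lborel)
      = (\<integral>\<^sup>+y. G y * indicator (?f ` UNIV) y \<partial>lborel)"
  proof (rule nn_integral_complex_substitution)
    show "(?f has_field_derivative a) (at x)" for x
      by (auto intro!: derivative_eq_intros)
    show "inj_on ?f UNIV" using a by (auto simp: inj_on_def)
    show "?f ` T \<in> sets borel" if "T \<in> sets borel" for T using m that by blast
  qed auto
  ultimately show ?thesis
    by (simp add: nn_integral_multc)
qed

section \<open>The Jacobi group\<close>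

type_synonym jacobi_elt = "(int \<times> int \<times> int \<times> int) \<times> (int \<times> int)"

text \<open>The law is dictated by composing the actions. An element first translates z and then
  applies its matrix, so in the product the row (l, m) passes through the second matrix M' and
  becomes (l, m) M' + (l', m').\<close>

fun jacobi_mult :: "jacobi_elt \<Rightarrow> jacobi_elt \<Rightarrow> jacobi_elt"
  where "jacobi_mult ((a, b, c, d), (l, m)) ((a', b', c', d'), (l', m')) =
    ((a * a' + b * c', a * b' + b * d', c * a' + d * c', c * b' + d * d'),
     (l' + l * a' + m * c', m' + l * b' + m * d'))"

text \<open>The translation part is -(l, m) times the inverse matrix.\<close>

fun jacobi_inv :: "jacobi_elt \<Rightarrow> jacobi_elt"
  where "jacobi_inv ((a, b, c, d), (l, m)) = ((d, - b, - c, a), (m * c - l * d, l * b - m * a))"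

text \<open>The last conclusion is the determinant relation multiplied by x, in the shape in which
  it occurs inside fully expanded products.\<close>

lemma jacobi_groupE:
  assumes "g \<in> jacobi_group"
  obtains a b c d l m where "g = ((a, b, c, d), (l, m))" "a * d - b * c = 1"
    "\<And>x. a * (d * x) = x + b * (c * x)"
proof -
  obtain a b c d l m where g: "g = ((a, b, c, d), (l, m))" by (metis surj_pair)
  have det: "a * d - b * c = 1" using assms by (simp add: g jacobi_group_def SL2Z_def)
  have "a * (d * x) = x + b * (c * x)" for x
  proof -
    have "a * (d * x) - b * (c * x) = (a * d - b * c) * x" by (simp add: algebra_simps)
    then show ?thesis unfolding det by simp
  qed
  with g det show thesis by (rule that)
qed

lemma jacobi_mult_in_group:
  assumes "g \<in> jacobi_group" "h \<in> jacobi_group"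
  shows "jacobi_mult g h \<in> jacobi_group"
proof -
  obtain a b c d l m where g: "g = ((a, b, c, d), (l, m))" "a * d - b * c = 1"
    using assms(1) by (rule jacobi_groupE)
  obtain a' b' c' d' l' m' where h: "h = ((a', b', c', d'), (l', m'))" "a' * d' - b' * c' = 1"
    using assms(2) by (rule jacobi_groupE)
  have "(a * a' + b * c') * (c * b' + d * d') - (a * b' + b * d') * (c * a' + d * c')
      = (a * d - b * c) * (a' * d' - b' * c')"
    by (simp add: algebra_simps)
  then show ?thesis using g h by (simp add: jacobi_group_def SL2Z_def)
qed

lemma jacobi_mult_assoc: "jacobi_mult (jacobi_mult f g) h = jacobi_mult f (jacobi_mult g h)"
  by (cases f rule: jacobi_inv.cases, cases g rule: jacobi_inv.cases, cases h rule: jacobi_inv.cases)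
    (simp add: algebra_simps)

lemma jacobi_inv_in_group: "g \<in> jacobi_group \<Longrightarrow> jacobi_inv g \<in> jacobi_group"
  by (erule jacobi_groupE) (simp add: jacobi_group_def SL2Z_def mult.commute)

lemma jacobi_inv_mult:
  assumes "g \<in> jacobi_group"
  shows "jacobi_mult (jacobi_inv g) g = ((1, 0, 0, 1), (0, 0))"
  using assms
proof (rule jacobi_groupE)
  fix a b c d l m
  assume g: "g = ((a, b, c, d), (l, m))" and det: "a * d - b * c = 1"
    and det': "\<And>x. a * (d * x) = x + b * (c * x)"
  have "a * d = 1 + b * c" using det by simp
  then show ?thesis unfolding g by (simp add: algebra_simps det')
qed

lemma jacobi_mult_inv:
  assumes "g \<in> jacobi_group"
  shows "jacobi_mult g (jacobi_inv g) = ((1, 0, 0, 1), (0, 0))"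
  using assms
proof (rule jacobi_groupE)
  fix a b c d l m
  assume g: "g = ((a, b, c, d), (l, m))" and det: "a * d - b * c = 1"
  have "a * d = 1 + b * c" using det by simp
  then show ?thesis unfolding g by (simp add: algebra_simps)
qed

lemma moebius_denom_nonzero:
  assumes "a * d - b * c = (1::int)" "Im \<tau> > 0"
  shows "of_int c * \<tau> + of_int d \<noteq> 0"
proof
  assume eq: "of_int c * \<tau> + of_int d = 0"
  then have "Im (of_int c * \<tau> + of_int d) = 0" by simp
  then have "c = 0" using assms(2) by simp
  with eq assms(1) show False by simp
qed

lemma Im_moebius:
  assumes "a * d - b * c = (1::int)"
  shows "Im ((of_int a * \<tau> + of_int b) / (of_int c * \<tau> + of_int d)) = Im \<tau> / (cmod (of_int c * \<tau> + of_int d))\<^sup>2"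
proof -
  have 1: "real_of_int a * real_of_int d - real_of_int b * real_of_int c = 1"
    using assms by (metis of_int_1 of_int_diff of_int_mult)
  have "a * Im \<tau> * (c * Re \<tau> + d) - (a * Re \<tau> + b) * (c * Im \<tau>)
      = Im \<tau> * (real_of_int a * real_of_int d - real_of_int b * real_of_int c)"
    by (simp add: algebra_simps)
  then show ?thesis using 1
    by (simp add: Im_divide cmod_power2)
qed

lemma jacobi_act_in_space:
  assumes "g \<in> jacobi_group" "p \<in> jacobi_space"
  shows "jacobi_act g p \<in> jacobi_space"
proof -
  obtain a b c d l m \<tau> z where [simp]: "g = ((a, b, c, d), (l, m))" "p = (\<tau>, z)"
    by (metis surj_pair)
  have "a * d - b * c = 1" "Im \<tau> > 0"
    using assms by (auto simp: jacobi_group_def SL2Z_def jacobi_space_def)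
  then show ?thesis
    using moebius_denom_nonzero [of a d b c \<tau>] Im_moebius [of a d b c \<tau>]
    by (simp add: jacobi_space_def)
qed

lemma jacobi_act_mult:
  assumes "g \<in> jacobi_group" "h \<in> jacobi_group" "p \<in> jacobi_space"
  shows "jacobi_act g (jacobi_act h p) = jacobi_act (jacobi_mult g h) p"
proof -
  obtain a b c d l m a' b' c' d' l' m' \<tau> z where ghp [simp]:
    "g = ((a, b, c, d), (l, m))" "h = ((a', b', c', d'), (l', m'))" "p = (\<tau>, z)"
    by (metis surj_pair)
  have det: "a * d - b * c = 1" "a' * d' - b' * c' = 1" and \<tau>: "Im \<tau> > 0"
    using assms by (auto simp: jacobi_group_def SL2Z_def jacobi_space_def)
  let ?J = "of_int c' * \<tau> + of_int d'"
  let ?K = "of_int c * (of_int a' * \<tau> + of_int b') + of_int d * ?J"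
  have J: "?J \<noteq> 0" using moebius_denom_nonzero det(2) \<tau> .
  have "jacobi_mult g h \<in> jacobi_group" using assms jacobi_mult_in_group by blast
  then have "(a * a' + b * c') * (c * b' + d * d') - (a * b' + b * d') * (c * a' + d * c') = 1"
    by (simp add: jacobi_group_def SL2Z_def)
  from moebius_denom_nonzero [OF this \<tau>]
  have K: "?K \<noteq> 0" by (simp add: algebra_simps)
  have K_eq: "?K = of_int (c * a' + d * c') * \<tau> + of_int (c * b' + d * d')"
    by (simp add: algebra_simps)
  \<comment> \<open>The cocycle relation j(gh, \<tau>) = j(g, h\<tau>) j(h, \<tau>) for the
    denominators, with \<open>?J\<close> = j(h, \<tau>) and \<open>?K\<close> = j(gh,
    \<tau>).\<close>
  have e0: "of_int c * ((of_int a' * \<tau> + of_int b') / ?J) + of_int d = ?K / ?J"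
  proof -
    have "\<alpha> * (y / j) + \<beta> = (\<alpha> * y + \<beta> * j) / j" if "j \<noteq> 0" for y \<alpha> \<beta> j :: complex
      using that by (simp add: field_simps)
    then show ?thesis using J .
  qed
  have frac: "(x / j + \<alpha> * (y / j) + \<beta>) / (k / j) = (x + \<alpha> * y + \<beta> * j) / k"
    if "j \<noteq> 0" "k \<noteq> 0" for x y \<alpha> \<beta> j k :: complex
    using that by (simp add: field_simps)
  have e1: "(of_int a * ((of_int a' * \<tau> + of_int b') / ?J) + of_int b) / (?K / ?J)
      = (of_int (a * a' + b * c') * \<tau> + of_int (a * b' + b * d')) / ?K"
  proof -
    have "(\<alpha> * (y / j) + \<beta>) / (k / j) = (\<alpha> * y + \<beta> * j) / k"
      if "j \<noteq> 0" "k \<noteq> 0" for y \<alpha> \<beta> j k :: complex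
      using that by (simp add: field_simps)
    note * = this [OF J K]
    show ?thesis unfolding * by (simp add: algebra_simps)
  qed
  have e2: "((z + of_int l' * \<tau> + of_int m') / ?J + of_int l * ((of_int a' * \<tau> + of_int b') / ?J) + of_int m) / (?K / ?J)
      = (z + of_int (l' + l * a' + m * c') * \<tau> + of_int (m' + l * b' + m * d')) / ?K"
    unfolding frac [OF J K] by (simp add: algebra_simps)
  show ?thesis
    using e1 e2 by (simp only: jacobi_act.simps jacobi_mult.simps e0 K_eq ghp)
qed

lemma jacobi_act_one: "jacobi_act ((1, 0, 0, 1), (0, 0)) p = p"
  by (cases p) simp

lemma jacobi_act_inv_act:
  "g \<in> jacobi_group \<Longrightarrow> p \<in> jacobi_space \<Longrightarrow> jacobi_act (jacobi_inv g) (jacobi_act g p) = p"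
  by (simp add: jacobi_act_mult jacobi_inv_in_group jacobi_inv_mult jacobi_act_one del: jacobi_act.simps)

lemma jacobi_act_act_inv:
  "g \<in> jacobi_group \<Longrightarrow> p \<in> jacobi_space \<Longrightarrow> jacobi_act g (jacobi_act (jacobi_inv g) p) = p"
  by (simp add: jacobi_act_mult jacobi_inv_in_group jacobi_mult_inv jacobi_act_one del: jacobi_act.simps)

lemma measurable_jacobi_act [measurable]: "jacobi_act g \<in> borel_measurable borel"
proof -
  obtain a b c d l m where g: "g = ((a, b, c, d), (l, m))" by (metis surj_pair)
  have "(\<lambda>p :: complex \<times> complex. ((of_int a * fst p + of_int b) / (of_int c * fst p + of_int d),
      (snd p + of_int l * fst p + of_int m) / (of_int c * fst p + of_int d)))
    \<in> borel_measurable borel"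
    unfolding borel_prod [symmetric] by measurable
  also have "(\<lambda>p :: complex \<times> complex. ((of_int a * fst p + of_int b) / (of_int c * fst p + of_int d),
      (snd p + of_int l * fst p + of_int m) / (of_int c * fst p + of_int d))) = jacobi_act g"
    by (auto simp: g)
  finally show ?thesis .
qed

lemma open_jacobi_space: "open jacobi_space"
proof -
  have "jacobi_space = {p. Im (fst p) > 0}" by (auto simp: jacobi_space_def)
  also have "open \<dots>" by (intro open_Collect_less continuous_intros)
  finally show ?thesis .
qed

section \<open>The invariant measure and fundamental domains\<close>

lemma sets_upper_half_plane [measurable]: "{\<tau>. Im \<tau> > 0} \<in> sets (borel :: complex measure)"
  by measurable

text \<open>The complex derivative is 1 / (c \<tau> + d)^2, and the real Jacobian is its squared
  modulus, hence the fourth power.\<close>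

lemma nn_integral_moebius:
  assumes det: "a * d - b * c = (1 :: int)" and [measurable]: "G \<in> borel_measurable borel"
  shows "(\<integral>\<^sup>+\<tau>. G ((of_int a * \<tau> + of_int b) / (of_int c * \<tau> + of_int d)) *
        ennreal (1 / cmod (of_int c * \<tau> + of_int d) ^ 4) * indicator {\<tau>. Im \<tau> > 0} \<tau> \<partial>lborel)
      = (\<integral>\<^sup>+\<tau>. G \<tau> * indicator {\<tau>. Im \<tau> > 0} \<tau> \<partial>lborel)"
proof -
  let ?H = "{\<tau>. Im \<tau> > 0}"
  define f where "f = (\<lambda>\<tau> :: complex. (of_int a * \<tau> + of_int b) / (of_int c * \<tau> + of_int d))"
  define f1 where "f1 = (\<lambda>\<tau> :: complex. (of_int d * \<tau> - of_int b) / (of_int a - of_int c * \<tau>))"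
  define f' where "f' = (\<lambda>\<tau> :: complex. 1 / (of_int c * \<tau> + of_int d)\<^sup>2)"
  have [measurable]: "f \<in> borel_measurable borel" "f1 \<in> borel_measurable borel" "f' \<in> borel_measurable borel"
    unfolding f_def f1_def f'_def by measurable
  \<comment> \<open>With no translation part the action preserves z = 0, so bijectivity on the upper
    half plane is read off from the group action at the points (\<tau>, 0).\<close>
  let ?g = "((a, b, c, d), (0, 0)) :: jacobi_elt"
  have g: "?g \<in> jacobi_group" using det by (simp add: jacobi_group_def SL2Z_def)
  have act: "jacobi_act ?g (\<tau>, 0) = (f \<tau>, 0)" "jacobi_act (jacobi_inv ?g) (\<tau>, 0) = (f1 \<tau>, 0)" for \<tau>
    by (simp_all add: f_def f1_def)
  have H: "(\<tau>, 0) \<in> jacobi_space \<longleftrightarrow> \<tau> \<in> ?H" for \<tau> by (simp add: jacobi_space_def)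
  have fH: "f \<tau> \<in> ?H" "f1 \<tau> \<in> ?H" "f1 (f \<tau>) = \<tau>" "f (f1 \<tau>) = \<tau>" if "\<tau> \<in> ?H" for \<tau>
  proof -
    have s: "(\<tau>, 0) \<in> jacobi_space" using that H by simp
    show "f \<tau> \<in> ?H" using jacobi_act_in_space [OF g s] unfolding act H .
    show "f1 \<tau> \<in> ?H" using jacobi_act_in_space [OF jacobi_inv_in_group [OF g] s] unfolding act H .
    show "f1 (f \<tau>) = \<tau>" using jacobi_act_inv_act [OF g s] unfolding act by simp
    show "f (f1 \<tau>) = \<tau>" using jacobi_act_act_inv [OF g s] unfolding act by simp
  qed
  have img: "f ` T = ?H \<inter> f1 -` T" if "T \<subseteq> ?H" for T
  proof (rule equalityI; rule subsetI)
    fix w assume "w \<in> f ` T"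
    then obtain \<tau> where "\<tau> \<in> T" "w = f \<tau>" by blast
    with that fH(1,3) [of \<tau>] show "w \<in> ?H \<inter> f1 -` T" by auto
  next
    fix w assume "w \<in> ?H \<inter> f1 -` T"
    with fH(4) [of w] show "w \<in> f ` T" by (intro image_eqI [of _ _ "f1 w"]) auto
  qed
  have "(\<integral>\<^sup>+\<tau>. G (f \<tau>) * ennreal ((cmod (f' \<tau>))\<^sup>2) * indicator ?H \<tau> \<partial>lborel)
      = (\<integral>\<^sup>+\<tau>. G \<tau> * indicator (f ` ?H) \<tau> \<partial>lborel)"
  proof (rule nn_integral_complex_substitution)
    show "f ` T \<in> sets borel" if "T \<in> sets borel" "T \<subseteq> ?H" for T
    proof -
      have "f1 -` T \<in> sets borel"
        by (rule measurable_sets_borel [OF _ that(1)]) measurable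
      then show ?thesis unfolding img [OF that(2)] by simp
    qed
    show "inj_on f ?H" using fH(3) by (rule inj_on_inverseI [of _ f1])
    show "(f has_field_derivative f' \<tau>) (at \<tau>)" if "\<tau> \<in> ?H" for \<tau>
    proof -
      have J: "of_int c * \<tau> + of_int d \<noteq> 0"
        using moebius_denom_nonzero [OF det] that by simp
      have "of_int a * (of_int c * \<tau> + of_int d) - (of_int a * \<tau> + of_int b) * of_int c = (of_int (a * d - b * c) :: complex)"
        by (simp add: algebra_simps)
      then have e: "of_int a * (of_int c * \<tau> + of_int d) - (of_int a * \<tau> + of_int b) * of_int c = 1"
        unfolding det by simp
      show ?thesis
        unfolding f_def f'_def using J
        by (auto intro!: derivative_eq_intros simp: e power2_eq_square)
    qed
  qed auto
  moreover have "f ` ?H = ?H"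
    using fH(2) by (subst img) auto
  moreover have "(cmod (f' \<tau>))\<^sup>2 = 1 / cmod (of_int c * \<tau> + of_int d) ^ 4" for \<tau>
    by (simp add: f'_def norm_divide norm_power power_divide)
  ultimately show ?thesis by (simp add: f_def)
qed

text \<open>The complement of \<open>jacobi_space\<close> is null for this measure, so
  almost-everywhere statements need checking only where the action behaves well.\<close>

definition jacobi_measure :: "(complex \<times> complex) measure"
  where "jacobi_measure = density lborel (\<lambda>p. ennreal (1 / Im (fst p) ^ 3) * indicator jacobi_space p)"

lemma sets_jacobi_space [measurable]: "jacobi_space \<in> sets borel"
  using open_jacobi_space by simp

lemma measurable_fst_complex [measurable]: "(fst :: complex \<times> complex \<Rightarrow> complex) \<in> borel_measurable borel"
  by (intro borel_measurable_continuous_onI continuous_intros)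

lemma measurable_snd_complex [measurable]: "(snd :: complex \<times> complex \<Rightarrow> complex) \<in> borel_measurable borel"
  by (intro borel_measurable_continuous_onI continuous_intros)

lemma sets_jacobi_measure [measurable_cong, simp]: "sets jacobi_measure = sets borel"
  by (simp add: jacobi_measure_def)

lemma space_jacobi_measure [simp]: "space jacobi_measure = UNIV"
  by (simp add: jacobi_measure_def)

lemma AE_jacobi_measure:
  "(AE p in jacobi_measure. P p) \<longleftrightarrow> (AE p in lborel. p \<in> jacobi_space \<longrightarrow> P p)"
proof -
  have "0 < ennreal (1 / Im (fst p) ^ 3) * indicator jacobi_space p \<longleftrightarrow> p \<in> jacobi_space" for p
    by (cases p) (auto simp: jacobi_space_def indicator_def)
  then show ?thesis
    unfolding jacobi_measure_def by (subst AE_density) auto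
qed

lemma nn_integral_jacobi_measure:
  assumes [measurable]: "G \<in> borel_measurable borel"
  shows "(\<integral>\<^sup>+p. G p \<partial>jacobi_measure)
    = (\<integral>\<^sup>+\<tau>. (\<integral>\<^sup>+z. G (\<tau>, z) \<partial>lborel) * ennreal (1 / Im \<tau> ^ 3) * indicator {\<tau>. Im \<tau> > 0} \<tau> \<partial>lborel)"
proof -
  have [measurable]: "G \<in> borel_measurable (borel \<Otimes>\<^sub>M borel)"
    unfolding borel_prod by simp
  have "(\<integral>\<^sup>+p. G p \<partial>jacobi_measure)
      = (\<integral>\<^sup>+p. G p * ennreal (1 / Im (fst p) ^ 3) * indicator {\<tau>. Im \<tau> > 0} (fst p) \<partial>(lborel \<Otimes>\<^sub>M lborel))"
    unfolding jacobi_measure_def lborel_prod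
    by (subst nn_integral_density)
      (auto simp: jacobi_space_def indicator_def mult.commute intro!: nn_integral_cong)
  also have "\<dots> = (\<integral>\<^sup>+\<tau>. \<integral>\<^sup>+z. G (\<tau>, z) * (ennreal (1 / Im \<tau> ^ 3) * indicator {\<tau>. Im \<tau> > 0} \<tau>) \<partial>lborel \<partial>lborel)"
    by (subst lborel.nn_integral_fst [symmetric]) (simp_all add: mult.assoc)
  also have "\<dots> = (\<integral>\<^sup>+\<tau>. (\<integral>\<^sup>+z. G (\<tau>, z) \<partial>lborel) * (ennreal (1 / Im \<tau> ^ 3) * indicator {\<tau>. Im \<tau> > 0} \<tau>) \<partial>lborel)"
    by (intro nn_integral_cong nn_integral_multc) measurable
  finally show ?thesis by (simp add: mult.assoc)
qed

text \<open>A count of powers of |c \<tau> + d|: the Jacobian in \<tau> contributes -4, the Jacobian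
  in z contributes -2, and v^3 is scaled by the power -6. Integrating over z first leaves an affine
  substitution for each fixed \<tau>.\<close>

lemma nn_integral_jacobi_act:
  assumes g: "g \<in> jacobi_group" and G [measurable]: "G \<in> borel_measurable borel"
  shows "(\<integral>\<^sup>+p. G (jacobi_act g p) \<partial>jacobi_measure) = (\<integral>\<^sup>+p. G p \<partial>jacobi_measure)"
proof -
  obtain a b c d l m where g': "g = ((a, b, c, d), (l, m))" and det: "a * d - b * c = 1"
    using g by (rule jacobi_groupE)
  have [measurable]: "G \<in> borel_measurable (borel \<Otimes>\<^sub>M borel)"
    unfolding borel_prod by simp
  let ?J = "\<lambda>\<tau> :: complex. of_int c * \<tau> + of_int d"
  let ?M = "\<lambda>\<tau> :: complex. (of_int a * \<tau> + of_int b) / ?J \<tau>"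
  define K where "K = (\<lambda>\<tau>. \<integral>\<^sup>+z. G (\<tau>, z) \<partial>lborel)"
  have [measurable]: "K \<in> borel_measurable borel"
    unfolding K_def by measurable
  have inner: "(\<integral>\<^sup>+z. G (jacobi_act g (\<tau>, z)) \<partial>lborel) * ennreal (1 / Im \<tau> ^ 3)
      = (K (?M \<tau>) * ennreal (1 / Im (?M \<tau>) ^ 3)) * ennreal (1 / cmod (?J \<tau>) ^ 4)"
    if \<tau>: "Im \<tau> > 0" for \<tau>
  proof -
    have J: "?J \<tau> \<noteq> 0" using moebius_denom_nonzero [OF det \<tau>] .
    have "(\<integral>\<^sup>+z. G (jacobi_act g (\<tau>, z)) \<partial>lborel)
        = (\<integral>\<^sup>+z. G (?M \<tau>, 1 / ?J \<tau> * z + (of_int l * \<tau> + of_int m) / ?J \<tau>) \<partial>lborel)"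
      by (simp add: g' add_divide_distrib add.assoc)
    then have "(\<integral>\<^sup>+z. G (jacobi_act g (\<tau>, z)) \<partial>lborel) * ennreal ((cmod (1 / ?J \<tau>))\<^sup>2) = K (?M \<tau>)"
      using nn_integral_complex_affine [of "\<lambda>z. G (?M \<tau>, z)" "1 / ?J \<tau>" "(of_int l * \<tau> + of_int m) / ?J \<tau>"] J
      by (simp add: K_def)
    note K_eq = this [symmetric]
    have "K (?M \<tau>) * ennreal (1 / Im (?M \<tau>) ^ 3) * ennreal (1 / cmod (?J \<tau>) ^ 4)
        = (\<integral>\<^sup>+z. G (jacobi_act g (\<tau>, z)) \<partial>lborel) *
          (ennreal ((cmod (1 / ?J \<tau>))\<^sup>2) * ennreal (1 / Im (?M \<tau>) ^ 3) * ennreal (1 / cmod (?J \<tau>) ^ 4))"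
      unfolding K_eq by (simp only: mult.assoc)
    also have "ennreal ((cmod (1 / ?J \<tau>))\<^sup>2) * ennreal (1 / Im (?M \<tau>) ^ 3) * ennreal (1 / cmod (?J \<tau>) ^ 4)
        = ennreal ((cmod (1 / ?J \<tau>))\<^sup>2 * (1 / Im (?M \<tau>) ^ 3) * (1 / cmod (?J \<tau>) ^ 4))"
      using \<tau> unfolding Im_moebius [OF det] by (simp add: ennreal_mult' [symmetric] ennreal_mult)
    also have "(cmod (1 / ?J \<tau>))\<^sup>2 * (1 / Im (?M \<tau>) ^ 3) * (1 / cmod (?J \<tau>) ^ 4) = 1 / Im \<tau> ^ 3"
    proof -
      have "(1 / j)\<^sup>2 * (1 / (v / j\<^sup>2) ^ 3) * (1 / j ^ 4) = 1 / v ^ 3" if "j > 0" "v > 0" for j v :: real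
        using that by (simp add: field_simps)
      from this [of "cmod (?J \<tau>)" "Im \<tau>"] show ?thesis
        unfolding Im_moebius [OF det] norm_divide norm_one using J \<tau> by simp
    qed
    finally show ?thesis by simp
  qed
  have "(\<integral>\<^sup>+p. G (jacobi_act g p) \<partial>jacobi_measure)
      = (\<integral>\<^sup>+\<tau>. (\<integral>\<^sup>+z. G (jacobi_act g (\<tau>, z)) \<partial>lborel) * ennreal (1 / Im \<tau> ^ 3) * indicator {\<tau>. Im \<tau> > 0} \<tau> \<partial>lborel)"
    by (rule nn_integral_jacobi_measure) measurable
  also have "\<dots> = (\<integral>\<^sup>+\<tau>. (K (?M \<tau>) * ennreal (1 / Im (?M \<tau>) ^ 3)) * ennreal (1 / cmod (?J \<tau>) ^ 4) * indicator {\<tau>. Im \<tau> > 0} \<tau> \<partial>lborel)"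
    by (intro nn_integral_cong) (use inner in \<open>auto simp: indicator_def\<close>)
  also have "\<dots> = (\<integral>\<^sup>+\<tau>. (K \<tau> * ennreal (1 / Im \<tau> ^ 3)) * indicator {\<tau>. Im \<tau> > 0} \<tau> \<partial>lborel)"
    by (rule nn_integral_moebius [OF det]) measurable
  also have "\<dots> = (\<integral>\<^sup>+p. G p \<partial>jacobi_measure)"
    unfolding K_def by (rule nn_integral_jacobi_measure [OF G, symmetric])
  finally show ?thesis .
qed

lemma AE_jacobi_act:
  assumes g: "g \<in> jacobi_group" and A: "A \<in> null_sets jacobi_measure"
  shows "AE p in jacobi_measure. jacobi_act g p \<notin> A"
proof -
  have [measurable]: "A \<in> sets borel" using A by auto
  have "(\<integral>\<^sup>+p. indicator A (jacobi_act g p) \<partial>jacobi_measure) = (\<integral>\<^sup>+p. indicator A p \<partial>jacobi_measure)"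
    by (rule nn_integral_jacobi_act [OF g]) measurable
  also have "\<dots> = 0" using A by auto
  finally have "AE p in jacobi_measure. indicator A (jacobi_act g p) = (0 :: ennreal)"
    by (subst (asm) nn_integral_0_iff_AE) auto
  then show ?thesis by (auto simp: indicator_def split: if_splits)
qed

lemma null_sets_jacobi_measure: "A \<in> null_sets lborel \<Longrightarrow> A \<in> null_sets jacobi_measure"
  unfolding jacobi_measure_def
  by (subst null_sets_density_iff) (auto dest: AE_not_in)

section \<open>Translates of a fundamental domain\<close>

lemma countable_jacobi_group: "countable jacobi_group"
  by (rule countable_subset [OF subset_UNIV countableI_type])

text \<open>If p lies in the translates of F by g and by h, then q = g^-1 p and h^-1 g q both lie in
  F. For distinct g and h such q form a null set, invariance moves that null set to the points p,
  and there are only countably many pairs.\<close>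

lemma fundamental_domain_unique_translate:
  assumes F: "jacobi_fundamental_domain F"
  shows "AE p in jacobi_measure. \<forall>g\<in>jacobi_group. \<forall>h\<in>jacobi_group.
    jacobi_act (jacobi_inv g) p \<in> F \<longrightarrow> jacobi_act (jacobi_inv h) p \<in> F \<longrightarrow> g = h"
proof -
  have "AE p in jacobi_measure. jacobi_act (jacobi_inv g) p \<in> F \<longrightarrow> jacobi_act (jacobi_inv h) p \<in> F \<longrightarrow> g = h"
    if g: "g \<in> jacobi_group" and h: "h \<in> jacobi_group" for g h
  proof (cases "g = h")
    case False
    let ?k = "jacobi_mult (jacobi_inv h) g"
    have k: "?k \<in> jacobi_group" using g h by (simp add: jacobi_mult_in_group jacobi_inv_in_group)
    have "?k \<noteq> ((1, 0, 0, 1), (0, 0))"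
    proof
      assume eq: "?k = ((1, 0, 0, 1), (0, 0))"
      have "g = jacobi_mult (jacobi_mult h (jacobi_inv h)) g"
        by (simp only: jacobi_mult_inv [OF h]) (cases g rule: jacobi_inv.cases, simp)
      also have "\<dots> = jacobi_mult h ?k" by (rule jacobi_mult_assoc)
      also have "\<dots> = h" unfolding eq by (cases h rule: jacobi_inv.cases) simp
      finally show False using False by simp
    qed
    then have "{p \<in> F. jacobi_act ?k p \<in> F} \<in> null_sets jacobi_measure"
      using F k unfolding jacobi_fundamental_domain_def by (intro null_sets_jacobi_measure) blast
    from AE_jacobi_act [OF jacobi_inv_in_group [OF g] this]
    have "AE p in jacobi_measure. \<not> (jacobi_act (jacobi_inv g) p \<in> F \<and> jacobi_act ?k (jacobi_act (jacobi_inv g) p) \<in> F)"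
      by simp
    then have "AE p in lborel. p \<in> jacobi_space \<longrightarrow> \<not> (jacobi_act (jacobi_inv g) p \<in> F \<and> jacobi_act ?k (jacobi_act (jacobi_inv g) p) \<in> F)"
      unfolding AE_jacobi_measure .
    then show ?thesis
      unfolding AE_jacobi_measure
    proof (rule eventually_mono, intro impI)
      fix p
      assume *: "p \<in> jacobi_space \<longrightarrow> \<not> (jacobi_act (jacobi_inv g) p \<in> F \<and> jacobi_act ?k (jacobi_act (jacobi_inv g) p) \<in> F)"
        and p: "p \<in> jacobi_space" and gF: "jacobi_act (jacobi_inv g) p \<in> F" and hF: "jacobi_act (jacobi_inv h) p \<in> F"
      have q: "jacobi_act (jacobi_inv g) p \<in> jacobi_space"
        using jacobi_act_in_space [OF jacobi_inv_in_group [OF g] p] .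
      have "jacobi_act ?k (jacobi_act (jacobi_inv g) p) = jacobi_act (jacobi_inv h) (jacobi_act g (jacobi_act (jacobi_inv g) p))"
        using jacobi_act_mult [OF jacobi_inv_in_group [OF h] g q] by simp
      also have "\<dots> = jacobi_act (jacobi_inv h) p" using jacobi_act_act_inv [OF g p] by simp
      finally show "g = h" using * p gF hF by simp
    qed
  qed simp
  then show ?thesis
    by (simp only: AE_ball_countable [OF countable_jacobi_group]) blast
qed

text \<open>Cut \<open>F\<close> into the pieces sent to \<open>S\<close> by the various \<open>g\<close>. Moved to \<open>S\<close>, the pieces
  overlap only in null sets.\<close>

lemma nn_integral_fundamental_domain_le:
  assumes F: "jacobi_fundamental_domain F"
    and f [measurable]: "f \<in> borel_measurable borel"
    and inv: "\<And>g p. g \<in> jacobi_group \<Longrightarrow> p \<in> jacobi_space \<Longrightarrow> f (jacobi_act g p) = f p"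
    and S [measurable]: "S \<in> sets borel"
    and cover: "\<And>p. p \<in> jacobi_space \<Longrightarrow> \<exists>g\<in>jacobi_group. jacobi_act g p \<in> S"
  shows "(\<integral>\<^sup>+p. f p * indicator F p \<partial>jacobi_measure) \<le> (\<integral>\<^sup>+p. f p * indicator S p \<partial>jacobi_measure)"
proof -
  let ?C = "count_space jacobi_group"
  have [measurable]: "F \<in> sets borel" using F by (simp add: jacobi_fundamental_domain_def)
  have space: "AE p in jacobi_measure. p \<in> jacobi_space" by (simp add: AE_jacobi_measure)
  have "(\<integral>\<^sup>+p. f p * indicator F p \<partial>jacobi_measure)
      \<le> (\<integral>\<^sup>+p. \<integral>\<^sup>+g. f p * indicator F p * indicator S (jacobi_act g p) \<partial>?C \<partial>jacobi_measure)"
  proof (rule nn_integral_mono_AE, rule eventually_mono [OF space])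
    fix p assume "p \<in> jacobi_space"
    then obtain g where "g \<in> jacobi_group" "jacobi_act g p \<in> S" using cover by blast
    then show "f p * indicator F p \<le> (\<integral>\<^sup>+g. f p * indicator F p * indicator S (jacobi_act g p) \<partial>?C)"
      using nn_integral_ge_point [of g jacobi_group "\<lambda>g. f p * indicator F p * indicator S (jacobi_act g p)"] by simp
  qed
  also have "\<dots> = (\<integral>\<^sup>+g. \<integral>\<^sup>+p. f p * indicator F p * indicator S (jacobi_act g p) \<partial>jacobi_measure \<partial>?C)"
    by (rule nn_integral_count_space_nn_integral [OF countable_jacobi_group]) measurable
  also have "\<dots> = (\<integral>\<^sup>+g. \<integral>\<^sup>+p. f p * indicator S p * indicator F (jacobi_act (jacobi_inv g) p) \<partial>jacobi_measure \<partial>?C)"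
  proof (rule nn_integral_cong)
    fix g assume "g \<in> space ?C"
    then have g: "g \<in> jacobi_group" by simp
    have "(\<integral>\<^sup>+p. f p * indicator F p * indicator S (jacobi_act g p) \<partial>jacobi_measure)
        = (\<integral>\<^sup>+p. f (jacobi_act (jacobi_inv g) p) * indicator F (jacobi_act (jacobi_inv g) p) *
            indicator S (jacobi_act g (jacobi_act (jacobi_inv g) p)) \<partial>jacobi_measure)"
      by (rule nn_integral_jacobi_act [OF jacobi_inv_in_group [OF g], symmetric]) measurable
    also have "\<dots> = (\<integral>\<^sup>+p. f p * indicator S p * indicator F (jacobi_act (jacobi_inv g) p) \<partial>jacobi_measure)"
      by (rule nn_integral_cong_AE, rule eventually_mono [OF space])
        (simp add: inv [OF jacobi_inv_in_group [OF g]] jacobi_act_act_inv [OF g] mult_ac)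
    finally show "(\<integral>\<^sup>+p. f p * indicator F p * indicator S (jacobi_act g p) \<partial>jacobi_measure)
        = (\<integral>\<^sup>+p. f p * indicator S p * indicator F (jacobi_act (jacobi_inv g) p) \<partial>jacobi_measure)" .
  qed
  also have "\<dots> = (\<integral>\<^sup>+p. \<integral>\<^sup>+g. f p * indicator S p * indicator F (jacobi_act (jacobi_inv g) p) \<partial>?C \<partial>jacobi_measure)"
    by (rule nn_integral_count_space_nn_integral [OF countable_jacobi_group, symmetric]) measurable
  also have "\<dots> \<le> (\<integral>\<^sup>+p. f p * indicator S p \<partial>jacobi_measure)"
  proof (rule nn_integral_mono_AE, rule eventually_mono [OF fundamental_domain_unique_translate [OF F]])
    fix p
    assume uniq: "\<forall>g\<in>jacobi_group. \<forall>h\<in>jacobi_group.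
      jacobi_act (jacobi_inv g) p \<in> F \<longrightarrow> jacobi_act (jacobi_inv h) p \<in> F \<longrightarrow> g = h"
    \<comment> \<open>The elements whose translate of F contains p. Almost everywhere there is at
      most one, so the sum over the group counts p at most once.\<close>
    let ?X = "{g \<in> jacobi_group. jacobi_act (jacobi_inv g) p \<in> F}"
    have "?X \<subseteq> {g}" if "g \<in> ?X" for g using uniq that by blast
    then have X_cases: "?X = {} \<or> (\<exists>g\<in>jacobi_group. ?X = {g})" by blast
    have "emeasure ?C ?X \<le> 1"
      using X_cases
    proof
      assume "?X = {}"
      then show ?thesis by (simp only: emeasure_empty) simp
    next
      assume "\<exists>g\<in>jacobi_group. ?X = {g}"
      then obtain g where "g \<in> jacobi_group" "?X = {g}" ..
      then show ?thesis by (simp only:) simp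
    qed
    moreover have "(\<integral>\<^sup>+g. indicator F (jacobi_act (jacobi_inv g) p) \<partial>?C) = (\<integral>\<^sup>+g. indicator ?X g \<partial>?C)"
      by (rule nn_integral_cong) (auto simp: indicator_def)
    ultimately have le1: "(\<integral>\<^sup>+g. indicator F (jacobi_act (jacobi_inv g) p) \<partial>?C) \<le> 1"
      by (simp add: nn_integral_indicator)
    have "(\<integral>\<^sup>+g. f p * indicator S p * indicator F (jacobi_act (jacobi_inv g) p) \<partial>?C)
        = f p * indicator S p * (\<integral>\<^sup>+g. indicator F (jacobi_act (jacobi_inv g) p) \<partial>?C)"
      by (rule nn_integral_cmult) simp
    also have "\<dots> \<le> f p * indicator S p * 1" by (rule mult_left_mono [OF le1]) simp
    finally show "(\<integral>\<^sup>+g. f p * indicator S p * indicator F (jacobi_act (jacobi_inv g) p) \<partial>?C) \<le> f p * indicator S p"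
      by simp
  qed
  finally show ?thesis .
qed

text \<open>The part \<open>A\<close> of F where f is nonzero is null, and so is the countable union
  of its preimages under the group. Almost every point has a translate in F, which then avoids
  \<open>A\<close>, and f has the same value at both.\<close>

lemma AE_eq_0_if_fundamental_domain:
  assumes F: "jacobi_fundamental_domain F"
    and f [measurable]: "f \<in> borel_measurable borel"
    and inv: "\<And>g p. g \<in> jacobi_group \<Longrightarrow> p \<in> jacobi_space \<Longrightarrow> f (jacobi_act g p) = (f p :: ennreal)"
    and zero: "(\<integral>\<^sup>+p. f p * indicator F p \<partial>jacobi_measure) = 0"
  shows "AE p in lborel. p \<in> jacobi_space \<longrightarrow> f p = 0"
proof -
  have [measurable]: "F \<in> sets borel" using F by (simp add: jacobi_fundamental_domain_def)
  define A where "A = {p \<in> F. f p \<noteq> 0}"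
  have "AE p in jacobi_measure. f p * indicator F p = 0"
    using zero by (subst (asm) nn_integral_0_iff_AE) auto
  then have "AE p in jacobi_measure. p \<notin> A"
    by (rule eventually_mono) (auto simp: A_def)
  then have "A \<in> null_sets jacobi_measure"
    by (subst AE_iff_null_sets) (auto simp: A_def)
  then have "AE p in jacobi_measure. \<forall>g\<in>jacobi_group. jacobi_act g p \<notin> A"
    by (simp add: AE_ball_countable countable_jacobi_group AE_jacobi_act)
  moreover have "AE p in jacobi_measure. \<exists>g\<in>jacobi_group. jacobi_act g p \<in> F"
    using F unfolding jacobi_fundamental_domain_def AE_jacobi_measure by blast
  ultimately have "AE p in jacobi_measure. p \<in> jacobi_space \<longrightarrow> f p = 0"
    by eventually_elim (use inv in \<open>auto simp: A_def\<close>)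
  then show ?thesis unfolding AE_jacobi_measure by auto
qed

section \<open>The invariant norm of a cusp form\<close>

definition jacobi_norm :: "int \<Rightarrow> nat \<Rightarrow> (complex \<times> complex \<Rightarrow> complex) \<Rightarrow> complex \<times> complex \<Rightarrow> real"
  where "jacobi_norm k N \<phi> p =
    (cmod (\<phi> p))\<^sup>2 * (Im (fst p) powi k * exp (- 4 * pi * real N * (Im (snd p))\<^sup>2 / Im (fst p)))"

lemma cusp_form_moebius:
  assumes "\<phi> \<in> jacobi_cusp_forms k N" "a * d - b * c = 1" "Im \<tau> > 0"
  shows "\<phi> ((of_int a * \<tau> + of_int b) / (of_int c * \<tau> + of_int d), z / (of_int c * \<tau> + of_int d)) =
      (of_int c * \<tau> + of_int d) powi k *
      exp (2 * of_real pi * \<i> * of_nat N * (of_int c * z\<^sup>2 / (of_int c * \<tau> + of_int d))) * \<phi> (\<tau>, z)"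
proof -
  have "(a, b, c, d) \<in> SL2Z" using assms(2) by (simp add: SL2Z_def)
  then show ?thesis using assms(1,3) unfolding jacobi_cusp_forms_def by blast
qed

lemma cusp_form_translate:
  assumes "\<phi> \<in> jacobi_cusp_forms k N" "Im \<tau> > 0"
  shows "\<phi> (\<tau>, z + of_int l * \<tau> + of_int m) =
      exp (- 2 * of_real pi * \<i> * of_nat N * ((of_int l)\<^sup>2 * \<tau> + 2 * of_int l * z)) * \<phi> (\<tau>, z)"
  using assms unfolding jacobi_cusp_forms_def by blast

lemma cusp_form_outside: "\<phi> \<in> jacobi_cusp_forms k N \<Longrightarrow> p \<notin> jacobi_space \<Longrightarrow> \<phi> p = 0"
  unfolding jacobi_cusp_forms_def by blast

text \<open>This balances the exponential automorphy factor against the weight: y^2 / v drops under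
  the matrix by exactly the imaginary part of c z^2 / (c \<tau> + d).\<close>

lemma Im_moebius_cocycle:
  fixes c d :: real and \<tau> z :: complex
  assumes "Im \<tau> > 0" and J: "of_real c * \<tau> + of_real d \<noteq> 0"
  shows "Im (of_real c * z\<^sup>2 / (of_real c * \<tau> + of_real d)) +
      (Im (z / (of_real c * \<tau> + of_real d)))\<^sup>2 / (Im \<tau> / (cmod (of_real c * \<tau> + of_real d))\<^sup>2) =
    (Im z)\<^sup>2 / Im \<tau>"
proof -
  obtain u v x y where \<tau>: "\<tau> = Complex u v" and z: "z = Complex x y" by (metis complex.exhaust)
  define p where "p = c * u + d"
  define n where "n = p\<^sup>2 + (c * v)\<^sup>2"
  have v: "v > 0" using assms(1) \<tau> by simp
  have Jeq: "of_real c * \<tau> + of_real d = Complex p (c * v)" by (simp add: \<tau> p_def complex_eq_iff)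
  have n: "n > 0"
    using J unfolding Jeq n_def by (auto simp: complex_eq_iff sum_power2_gt_zero_iff)
  have "Im (of_real c * z\<^sup>2 / Complex p (c * v)) = c * (2 * x * y * p - (x\<^sup>2 - y\<^sup>2) * (c * v)) / n"
    by (simp add: z n_def Im_divide power2_eq_square algebra_simps)
  moreover have "Im (z / Complex p (c * v)) = (y * p - x * (c * v)) / n"
    by (simp add: z n_def Im_divide)
  moreover have "(cmod (Complex p (c * v)))\<^sup>2 = n" by (simp add: cmod_power2 n_def)
  moreover have "c * (2 * x * y * p - (x\<^sup>2 - y\<^sup>2) * (c * v)) / n + ((y * p - x * (c * v)) / n)\<^sup>2 / (v / n)
      = (c * v * (2 * x * y * p - (x\<^sup>2 - y\<^sup>2) * (c * v)) + (y * p - x * (c * v))\<^sup>2) / (n * v)"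
    using n v by (simp add: field_simps power2_eq_square)
  moreover have "c * v * (2 * x * y * p - (x\<^sup>2 - y\<^sup>2) * (c * v)) + (y * p - x * (c * v))\<^sup>2 = y\<^sup>2 * n"
    unfolding n_def by (simp add: power2_eq_square algebra_simps)
  moreover have "y\<^sup>2 * n / (n * v) = y\<^sup>2 / v" using n by simp
  ultimately show ?thesis unfolding Jeq by (simp add: \<tau> z)
qed

lemma jacobi_norm_moebius:
  assumes \<phi>: "\<phi> \<in> jacobi_cusp_forms k N" and det: "a * d - b * c = 1" and \<tau>: "Im \<tau> > 0"
  shows "jacobi_norm k N \<phi> ((of_int a * \<tau> + of_int b) / (of_int c * \<tau> + of_int d), z / (of_int c * \<tau> + of_int d))
    = jacobi_norm k N \<phi> (\<tau>, z)"
proof -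
  define J where "J = of_int c * \<tau> + of_int d"
  have J: "J \<noteq> 0" unfolding J_def using moebius_denom_nonzero [OF det \<tau>] .
  define A where "A = Im (of_int c * z\<^sup>2 / J)"
  define B where "B = (Im (z / J))\<^sup>2 / (Im \<tau> / (cmod J)\<^sup>2)"
  have AB: "A + B = (Im z)\<^sup>2 / Im \<tau>"
    using Im_moebius_cocycle [OF \<tau>, of "of_int c" "of_int d" z] J
    by (simp add: A_def B_def J_def)
  have "(cmod (exp (2 * of_real pi * \<i> * of_nat N * w)))\<^sup>2 = exp (- 4 * pi * real N * Im w)" for w
    by (simp add: power2_eq_square exp_add [symmetric])
  then have e: "(cmod (exp (2 * of_real pi * \<i> * of_nat N * (of_int c * z\<^sup>2 / J))))\<^sup>2 = exp (- 4 * pi * real N * A)"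
    unfolding A_def .
  have p: "(cmod (J powi k))\<^sup>2 * (Im \<tau> / (cmod J)\<^sup>2) powi k = Im \<tau> powi k"
    using J by (simp add: norm_power_int power_int_divide_distrib power2_eq_square power_int_mult_distrib)
  have "jacobi_norm k N \<phi> ((of_int a * \<tau> + of_int b) / J, z / J) =
      (cmod (J powi k))\<^sup>2 * (cmod (exp (2 * of_real pi * \<i> * of_nat N * (of_int c * z\<^sup>2 / J))))\<^sup>2 * (cmod (\<phi> (\<tau>, z)))\<^sup>2 *
      ((Im \<tau> / (cmod J)\<^sup>2) powi k * exp (- 4 * pi * real N * (Im (z / J))\<^sup>2 / (Im \<tau> / (cmod J)\<^sup>2)))"
    unfolding jacobi_norm_def fst_conv snd_conv J_def Im_moebius [OF det] cusp_form_moebius [OF \<phi> det \<tau>]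
    by (simp only: norm_mult power_mult_distrib)
  also have "\<dots> = ((cmod (J powi k))\<^sup>2 * (Im \<tau> / (cmod J)\<^sup>2) powi k) * (cmod (\<phi> (\<tau>, z)))\<^sup>2 *
      (exp (- 4 * pi * real N * A) * exp (- 4 * pi * real N * B))"
    unfolding e B_def by (simp add: mult_ac)
  also have "exp (- 4 * pi * real N * A) * exp (- 4 * pi * real N * B) = exp (- 4 * pi * real N * (A + B))"
    by (simp add: exp_add [symmetric] algebra_simps)
  also have "((cmod (J powi k))\<^sup>2 * (Im \<tau> / (cmod J)\<^sup>2) powi k) * (cmod (\<phi> (\<tau>, z)))\<^sup>2 * exp (- 4 * pi * real N * (A + B))
      = jacobi_norm k N \<phi> (\<tau>, z)"
    unfolding p AB by (simp add: jacobi_norm_def mult_ac)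
  finally show ?thesis unfolding J_def .
qed

text \<open>(y + l v)^2 / v exceeds y^2 / v by l^2 v + 2 l y, the exponent contributed by the
  automorphy factor.\<close>

lemma jacobi_norm_translate:
  assumes \<phi>: "\<phi> \<in> jacobi_cusp_forms k N" and \<tau>: "Im \<tau> > 0"
  shows "jacobi_norm k N \<phi> (\<tau>, z + of_int l * \<tau> + of_int m) = jacobi_norm k N \<phi> (\<tau>, z)"
proof -
  let ?E = "exp (- 2 * of_real pi * \<i> * of_nat N * ((of_int l)\<^sup>2 * \<tau> + 2 * of_int l * z))"
  have i2: "Im ((of_int l :: complex)\<^sup>2 * \<tau> + 2 * of_int l * z) = (of_int l)\<^sup>2 * Im \<tau> + 2 * of_int l * Im z"
    by (simp add: power2_eq_square)
  have "Re (- 2 * of_real pi * \<i> * of_nat N * w) = 2 * pi * real N * Im w" for w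
    by simp
  then have "(cmod ?E)\<^sup>2 = exp (4 * pi * real N * ((of_int l)\<^sup>2 * Im \<tau> + 2 * of_int l * Im z))"
    unfolding norm_exp_eq_Re i2 by (simp only: i2) (simp add: power2_eq_square exp_add [symmetric])
  then have e: "(cmod ?E)\<^sup>2 * exp (- 4 * pi * real N * (Im (z + of_int l * \<tau> + of_int m))\<^sup>2 / Im \<tau>)
      = exp (- 4 * pi * real N * (Im z)\<^sup>2 / Im \<tau>)"
    using \<tau> by (simp add: exp_add [symmetric] field_simps power2_eq_square)
  have "jacobi_norm k N \<phi> (\<tau>, z + of_int l * \<tau> + of_int m)
      = (cmod (\<phi> (\<tau>, z)))\<^sup>2 * (Im \<tau> powi k * ((cmod ?E)\<^sup>2 * exp (- 4 * pi * real N * (Im (z + of_int l * \<tau> + of_int m))\<^sup>2 / Im \<tau>)))"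
    unfolding jacobi_norm_def cusp_form_translate [OF \<phi> \<tau>] fst_conv snd_conv
    by (simp only: norm_mult power_mult_distrib mult_ac)
  then show ?thesis unfolding e by (simp add: jacobi_norm_def)
qed

lemma jacobi_norm_act:
  assumes \<phi>: "\<phi> \<in> jacobi_cusp_forms k N" and g: "g \<in> jacobi_group" and p: "p \<in> jacobi_space"
  shows "jacobi_norm k N \<phi> (jacobi_act g p) = jacobi_norm k N \<phi> p"
proof -
  obtain a b c d l m where g': "g = ((a, b, c, d), (l, m))" and det: "a * d - b * c = 1"
    using g by (rule jacobi_groupE)
  obtain \<tau> z where p': "p = (\<tau>, z)" "Im \<tau> > 0" using p by (auto simp: jacobi_space_def)
  show ?thesis
    unfolding g' p' jacobi_act.simps jacobi_norm_moebius [OF \<phi> det p'(2)]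
      jacobi_norm_translate [OF \<phi> p'(2)] ..
qed

text \<open>Off \<open>jacobi_space\<close> the power of Im \<tau> may be negative, but there \<phi>
  is 0.\<close>

lemma jacobi_norm_nonneg: "\<phi> \<in> jacobi_cusp_forms k N \<Longrightarrow> jacobi_norm k N \<phi> p \<ge> 0"
  using cusp_form_outside [of \<phi> k N p]
  by (cases p; cases "p \<in> jacobi_space") (auto simp: jacobi_norm_def jacobi_space_def)

lemma continuous_on_cusp_form:
  assumes "\<phi> \<in> jacobi_cusp_forms k N"
  shows "continuous_on jacobi_space \<phi>"
proof -
  have "holomorphic2_on \<phi> jacobi_space" using assms by (simp add: jacobi_cusp_forms_def)
  then show ?thesis
    unfolding holomorphic2_on_def by (meson continuous_at_imp_continuous_on has_derivative_continuous)
qed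

lemma measurable_cusp_form:
  assumes "\<phi> \<in> jacobi_cusp_forms k N"
  shows "\<phi> \<in> borel_measurable borel"
proof -
  have "(\<lambda>p. indicator jacobi_space p *\<^sub>R \<phi> p) \<in> borel_measurable borel"
    by (rule borel_measurable_continuous_on_indicator)
      (use continuous_on_cusp_form [OF assms] in auto)
  also have "(\<lambda>p. indicator jacobi_space p *\<^sub>R \<phi> p) = \<phi>"
    using cusp_form_outside [OF assms] by (auto simp: fun_eq_iff indicator_def)
  finally show ?thesis .
qed

lemma measurable_weight [measurable]:
  "(\<lambda>p :: complex \<times> complex. Im (fst p) powi k * exp (- 4 * pi * real N * (Im (snd p))\<^sup>2 / Im (fst p)))
    \<in> borel_measurable borel"
  unfolding power_int_def by measurable

lemma measurable_jacobi_norm: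
  assumes "\<phi> \<in> jacobi_cusp_forms k N"
  shows "jacobi_norm k N \<phi> \<in> borel_measurable borel"
proof -
  have [measurable]: "\<phi> \<in> borel_measurable borel" by (rule measurable_cusp_form [OF assms])
  show ?thesis unfolding jacobi_norm_def by measurable
qed

section \<open>The Siegel set: covering property and finite volume\<close>

definition siegel_set :: "(complex \<times> complex) set"
  where "siegel_set = {p. 0 \<le> Re (fst p) \<and> Re (fst p) \<le> 1 \<and> 1 / 5 \<le> Im (fst p) \<and>
    0 \<le> Re (snd p) \<and> Re (snd p) \<le> 1 \<and> 0 \<le> Im (snd p) \<and> Im (snd p) \<le> Im (fst p)}"

lemma sets_siegel_set [measurable]: "siegel_set \<in> sets borel"
  unfolding siegel_set_def by measurable

text \<open>For v = Im \<tau> < 1, Dirichlet approximation of Re \<tau> with bound Q between 1 /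
  sqrt v and 2 / sqrt v makes the real part of the denominator at most sqrt v and its imaginary part
  at most 2 sqrt v. The squares add up to v + 4 v, the origin of 5 here and of 1 / 5 in
  \<open>siegel_set\<close>.\<close>

lemma small_denominator:
  assumes \<tau>: "Im \<tau> > 0"
  obtains c d :: int where "coprime c d" "(cmod (of_int c * \<tau> + of_int d))\<^sup>2 \<le> 5 * Im \<tau>"
proof (cases "Im \<tau> \<ge> 1")
  case True
  then show thesis by (intro that [of 0 1]) auto
next
  case False
  define s where "s = sqrt (Im \<tau>)"
  have s: "0 < s" "s < 1" "s\<^sup>2 = Im \<tau>" using \<tau> False by (auto simp: s_def)
  define Q where "Q = nat \<lceil>1 / s\<rceil>"
  have "real Q = of_int \<lceil>1 / s\<rceil>"
    using s by (simp add: Q_def)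
  then have Q1: "1 / s \<le> real Q" "real Q \<le> 1 / s + 1" by linarith+
  have "1 < 1 / s" using s by simp
  then have Q0: "Q > 0" "real Q \<le> 2 / s" using Q1 by auto
  obtain h q where hq: "coprime h q" "0 < q" "q \<le> int Q" "\<bar>of_int q * Re \<tau> - of_int h\<bar> < 1 / Q"
    using Dirichlet_approx_coprime [OF Q0(1)] by blast
  have "\<bar>of_int q * Re \<tau> - of_int h\<bar> \<le> s"
  proof -
    have "1 / real Q \<le> s" using Q1(1) Q0(1) s(1) by (simp add: field_simps)
    then show ?thesis using hq(4) by linarith
  qed
  then have 1: "(of_int q * Re \<tau> - of_int h)\<^sup>2 \<le> s\<^sup>2"
    using abs_le_square_iff [of "of_int q * Re \<tau> - of_int h" s] s(1) by simp
  have "of_int q \<le> 2 / s"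
  proof -
    have "real_of_int q \<le> real Q" using hq(3) by linarith
    then show ?thesis using Q0(2) by linarith
  qed
  then have "of_int q * s \<le> 2" using s(1) by (simp add: field_simps)
  then have "(of_int q * s)\<^sup>2 \<le> 2\<^sup>2" using hq(2) s(1) by (intro power_mono) auto
  then have "(of_int q * s)\<^sup>2 * s\<^sup>2 \<le> 4 * s\<^sup>2" by (intro mult_right_mono) auto
  then have 2: "(of_int q * Im \<tau>)\<^sup>2 \<le> 4 * s\<^sup>2"
    by (simp add: s(3) [symmetric] power2_eq_square mult_ac)
  have "(cmod (of_int q * \<tau> + of_int (- h)))\<^sup>2 = (of_int q * Re \<tau> - of_int h)\<^sup>2 + (of_int q * Im \<tau>)\<^sup>2"
    by (simp add: cmod_power2)
  also have "\<dots> \<le> 5 * Im \<tau>" using 1 2 s(3) by linarith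
  finally show thesis using hq(1) by (intro that [of q "- h"]) (auto simp: coprime_commute)
qed

text \<open>The small denominator is completed to a matrix by Bezout and lifts Im \<tau> to at least
  1 / 5. The later moves shift \<tau> by an integer and z by a lattice vector, so they keep that
  height.\<close>

lemma siegel_set_covers:
  assumes p: "p \<in> jacobi_space"
  shows "\<exists>g\<in>jacobi_group. jacobi_act g p \<in> siegel_set"
proof -
  obtain \<tau> z where p': "p = (\<tau>, z)" and \<tau>: "Im \<tau> > 0" using p by (auto simp: jacobi_space_def)
  obtain c d :: int where cd: "coprime c d" "(cmod (of_int c * \<tau> + of_int d))\<^sup>2 \<le> 5 * Im \<tau>"
    using small_denominator [OF \<tau>] .
  obtain a b' where "a * d + b' * c = 1"
    using bezout_int [of d c] cd(1) by (auto simp: coprime_iff_gcd_eq_1 gcd.commute)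
  then have det: "a * d - (- b') * c = 1" by simp
  define g1 where "g1 = ((a, - b', c, d), (0 :: int, 0 :: int))"
  have g1: "g1 \<in> jacobi_group" using det by (simp add: g1_def jacobi_group_def SL2Z_def)
  obtain \<tau>1 z1 where p1: "jacobi_act g1 p = (\<tau>1, z1)" by fastforce
  have J: "of_int c * \<tau> + of_int d \<noteq> 0" using moebius_denom_nonzero [OF det \<tau>] .
  have "Im \<tau>1 = Im \<tau> / (cmod (of_int c * \<tau> + of_int d))\<^sup>2"
    using p1 Im_moebius [OF det, of \<tau>] by (auto simp: g1_def p')
  then have v1: "Im \<tau>1 \<ge> 1 / 5" using cd(2) J by (simp add: pos_le_divide_eq)
  define \<tau>2 where "\<tau>2 = \<tau>1 - of_int \<lfloor>Re \<tau>1\<rfloor>"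
  define g2 :: jacobi_elt where "g2 = ((1, - \<lfloor>Re \<tau>1\<rfloor>, 0, 1), (0, 0))"
  have g2: "g2 \<in> jacobi_group" by (simp add: g2_def jacobi_group_def SL2Z_def)
  have p2: "jacobi_act g2 (\<tau>1, z1) = (\<tau>2, z1)" by (simp add: g2_def \<tau>2_def)
  have v2: "Im \<tau>2 \<ge> 1 / 5" "0 \<le> Re \<tau>2" "Re \<tau>2 \<le> 1"
    unfolding \<tau>2_def using v1 by (simp, simp, simp) linarith
  \<comment> \<open>The multiple of \<tau> settles Im z. The integer \<open>m\<close> is chosen
    afterwards, since a real shift adjusts Re z without disturbing Im z.\<close>
  define l where "l = - \<lfloor>Im z1 / Im \<tau>2\<rfloor>"
  define m where "m = - \<lfloor>Re (z1 + of_int l * \<tau>2)\<rfloor>"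
  define g3 :: jacobi_elt where "g3 = ((1, 0, 0, 1), (l, m))"
  have g3: "g3 \<in> jacobi_group" by (simp add: g3_def jacobi_group_def SL2Z_def)
  have p3: "jacobi_act g3 (\<tau>2, z1) = (\<tau>2, z1 + of_int l * \<tau>2 + of_int m)" by (simp add: g3_def)
  have "Im (z1 + of_int l * \<tau>2 + of_int m) = (Im z1 / Im \<tau>2 + of_int l) * Im \<tau>2"
    using v2 by (simp add: field_simps)
  moreover have "0 \<le> Im z1 / Im \<tau>2 + of_int l" "Im z1 / Im \<tau>2 + of_int l \<le> 1"
    unfolding l_def by (simp, simp) linarith
  ultimately have y: "0 \<le> Im (z1 + of_int l * \<tau>2 + of_int m)" "Im (z1 + of_int l * \<tau>2 + of_int m) \<le> Im \<tau>2"
    using v2(1) by (simp_all add: mult_left_le_one_le)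
  have "Re (z1 + of_int l * \<tau>2 + of_int m) = Re (z1 + of_int l * \<tau>2) - of_int \<lfloor>Re (z1 + of_int l * \<tau>2)\<rfloor>"
    by (simp add: m_def)
  then have x: "0 \<le> Re (z1 + of_int l * \<tau>2 + of_int m)" "Re (z1 + of_int l * \<tau>2 + of_int m) \<le> 1"
    by linarith+
  have in_S: "(\<tau>2, z1 + of_int l * \<tau>2 + of_int m) \<in> siegel_set"
    unfolding siegel_set_def using v2 x y by simp
  have "jacobi_act (jacobi_mult g3 (jacobi_mult g2 g1)) p = jacobi_act g3 (jacobi_act (jacobi_mult g2 g1) p)"
    by (rule jacobi_act_mult [OF g3 jacobi_mult_in_group [OF g2 g1] p, symmetric])
  also have "jacobi_act (jacobi_mult g2 g1) p = (\<tau>2, z1)"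
    using jacobi_act_mult [OF g2 g1 p] unfolding p1 p2 by simp
  finally have "jacobi_act (jacobi_mult g3 (jacobi_mult g2 g1)) p \<in> siegel_set"
    unfolding p3 using in_S by simp
  then show ?thesis using jacobi_mult_in_group [OF g3 jacobi_mult_in_group [OF g2 g1]] by blast
qed

text \<open>The fibre over \<tau> is a rectangle of area v, so the density v^-3 becomes v^-2.
  Cutting the strip into unit squares compares the integral with the sum of inverse squares.\<close>

lemma emeasure_siegel_set_finite: "emeasure jacobi_measure siegel_set < \<infinity>"
proof -
  let ?H = "{\<tau>. Im \<tau> > 0}"
  define R where "R = (\<lambda>n :: nat. cbox (Complex 0 (1 / 5 + real n)) (Complex 1 (1 / 5 + real (Suc n))))"
  have R: "emeasure lborel (R n) = 1" for n
    unfolding R_def by (simp add: emeasure_lborel_cbox_eq Basis_complex_def)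
  have [measurable]: "R n \<in> sets borel" for n by (simp add: R_def)
  have inner: "(\<integral>\<^sup>+z. indicator siegel_set (\<tau>, z) \<partial>lborel) * ennreal (1 / Im \<tau> ^ 3) * indicator ?H \<tau>
      \<le> (\<Sum>n. ennreal (25 / real (Suc n) ^ 2) * indicator (R n) \<tau>)" for \<tau>
  proof (cases "0 \<le> Re \<tau> \<and> Re \<tau> \<le> 1 \<and> 1 / 5 \<le> Im \<tau>")
    case False
    then have "(\<lambda>z. indicator siegel_set (\<tau>, z) :: ennreal) = (\<lambda>z. 0)"
      by (auto simp: siegel_set_def indicator_def fun_eq_iff)
    then show ?thesis by simp
  next
    case True
    define n where "n = nat \<lfloor>Im \<tau> - 1 / 5\<rfloor>"
    have n: "1 / 5 + real n \<le> Im \<tau>" "Im \<tau> \<le> 1 / 5 + real (Suc n)"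
      using True unfolding n_def by auto linarith+
    have "(\<lambda>z. indicator siegel_set (\<tau>, z) :: ennreal) = indicator (cbox 0 (Complex 1 (Im \<tau>)))"
      using True by (auto simp: siegel_set_def indicator_def fun_eq_iff in_cbox_complex_iff)
    then have "(\<integral>\<^sup>+z. indicator siegel_set (\<tau>, z) \<partial>lborel) = ennreal (Im \<tau>)"
      using True by (simp add: emeasure_lborel_cbox_eq Basis_complex_def)
    then have "(\<integral>\<^sup>+z. indicator siegel_set (\<tau>, z) \<partial>lborel) * ennreal (1 / Im \<tau> ^ 3) * indicator ?H \<tau>
        = ennreal (1 / (Im \<tau>)\<^sup>2)"
      using True by (simp add: ennreal_mult [symmetric] power2_eq_square power3_eq_cube)
    also have "\<dots> \<le> ennreal (25 / real (Suc n) ^ 2)"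
    proof (rule ennreal_leI)
      \<comment> \<open>From 1 / 5 + n \<le> v one gets (n + 1) / 5 \<le> v, whence the constant
        25.\<close>
      have "real (Suc n) \<le> 5 * Im \<tau>" using n(1) by simp
      then have "(real (Suc n))\<^sup>2 \<le> (5 * Im \<tau>)\<^sup>2" by (intro power_mono) auto
      then have "25 / (5 * Im \<tau>)\<^sup>2 \<le> 25 / real (Suc n) ^ 2"
        by (rule divide_left_mono) (use True in auto)
      then show "1 / (Im \<tau>)\<^sup>2 \<le> 25 / real (Suc n) ^ 2"
        by (simp add: power_mult_distrib)
    qed
    also have "\<dots> = ennreal (25 / real (Suc n) ^ 2) * indicator (R n) \<tau>"
      using n True by (simp add: R_def in_cbox_complex_iff)
    also have "\<dots> \<le> (\<Sum>n. ennreal (25 / real (Suc n) ^ 2) * indicator (R n) \<tau>)"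
    proof -
      define f where "f = (\<lambda>n. ennreal (25 / real (Suc n) ^ 2) * indicator (R n) \<tau>)"
      have "sum f {n} \<le> suminf f" by (rule sum_le_suminf) auto
      then have "f n \<le> suminf f" by simp
      then show ?thesis by (simp only: f_def)
    qed
    finally show ?thesis .
  qed
  have "emeasure jacobi_measure siegel_set = (\<integral>\<^sup>+p. indicator siegel_set p \<partial>jacobi_measure)"
    by simp
  also have "\<dots> = (\<integral>\<^sup>+\<tau>. (\<integral>\<^sup>+z. indicator siegel_set (\<tau>, z) \<partial>lborel) * ennreal (1 / Im \<tau> ^ 3) * indicator ?H \<tau> \<partial>lborel)"
    by (rule nn_integral_jacobi_measure) measurable
  also have "\<dots> \<le> (\<integral>\<^sup>+\<tau>. (\<Sum>n. ennreal (25 / real (Suc n) ^ 2) * indicator (R n) \<tau>) \<partial>lborel)"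
    by (intro nn_integral_mono inner)
  also have "\<dots> = (\<Sum>n. ennreal (25 / real (Suc n) ^ 2))"
    by (subst nn_integral_suminf) (simp_all add: nn_integral_cmult_indicator R)
  also have "\<dots> < \<infinity>"
  proof -
    have "summable (\<lambda>n. 25 * (1 / real (Suc n) ^ 2))"
      using inverse_squares_sums by (intro summable_mult) (simp add: sums_iff)
    then have "(\<Sum>n. ennreal (25 / real (Suc n) ^ 2)) = ennreal (\<Sum>n. 25 / real (Suc n) ^ 2)"
      by (intro suminf_ennreal2) auto
    then show ?thesis by simp
  qed
  finally show ?thesis .
qed

section \<open>Boundedness of cusp forms on the Siegel set\<close>

lemma powi_times_exp_bounded:
  assumes c: "c > 0" and v0: "(v0 :: real) > 0"
  obtains K where "\<And>v. v \<ge> v0 \<Longrightarrow> v powi k * exp (- c * v) \<le> K"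
proof (cases "k > 0")
  case False
  show thesis
  proof (rule that [of "v0 powi k * 1"])
    fix v assume v: "v \<ge> v0"
    have "inverse v \<le> inverse v0" using v v0 by simp
    then have "inverse v ^ nat (- k) \<le> inverse v0 ^ nat (- k)"
      using v v0 by (intro power_mono) auto
    then have "v powi k \<le> v0 powi k" using False by (simp add: power_int_def)
    moreover have "exp (- c * v) \<le> 1" using c v v0 by simp
    ultimately show "v powi k * exp (- c * v) \<le> v0 powi k * 1"
      using v0 v by (intro mult_mono) auto
  qed
next
  case True
  define n where "n = nat k"
  have n: "n > 0" and k: "k = int n" using True by (auto simp: n_def)
  show thesis
  proof (rule that [of "(real n / c) ^ n"])
    fix v assume v: "v \<ge> v0"
    have "(c * v / real n) ^ n \<le> (1 + c * v / real n) ^ n"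
      using c v v0 by (intro power_mono) auto
    also have "\<dots> \<le> exp (c * v)"
      using c v v0 n by (intro exp_ge_one_plus_x_over_n_power_n) (auto intro: order_trans [of _ 0])
    finally have "(c * v / real n) ^ n * (real n / c) ^ n \<le> exp (c * v) * (real n / c) ^ n"
      using c by (intro mult_right_mono) auto
    moreover have "(c * v / real n) ^ n * (real n / c) ^ n = v ^ n"
      using c n by (simp add: power_mult_distrib [symmetric])
    ultimately show "v powi k * exp (- c * v) \<le> (real n / c) ^ n"
      using c by (simp add: k exp_minus field_simps)
  qed
qed

text \<open>Each weighted Fourier term is bounded by its absolute values at two fixed points, times
  a factor decaying in v that is common to all terms. Absolute convergence at the two points bounds
  the sum, and the decay beats v^k. Half of the exponent of the weight is attached to |\<phi>|,
  because the norm contains the square.\<close>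

lemma jacobi_norm_bounded_on_siegel_set:
  assumes N: "N \<ge> 1" and \<phi>: "\<phi> \<in> jacobi_cusp_forms k N"
  shows "\<exists>K. \<forall>p\<in>siegel_set. jacobi_norm k N \<phi> p \<le> K"
proof -
  define C where "C = jacobi_coeff N \<phi>"
  have C: "has_jacobi_expansion N \<phi> C"
    unfolding C_def by (rule has_jacobi_expansion_jacobi_coeff [OF N \<phi>])
  define n where "n = (\<lambda>a :: int \<times> int. (of_int (snd a))\<^sup>2 / (4 * real N) - of_int (fst a) / (4 * real N))"
  define t where "t = (\<lambda>\<tau> z (a :: int \<times> int). C a *
      exp (2 * of_real pi * \<i> * (of_int ((snd a)\<^sup>2 - fst a) / of_nat (4 * N) * \<tau> + of_int (snd a) * z)))"
  have exps: "(t \<tau> z has_sum \<phi> (\<tau>, z)) (admissible N)" if "Im \<tau> > 0" for \<tau> z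
    using C that unfolding has_jacobi_expansion_def t_def case_prod_unfold by simp
  have norm_t: "cmod (t \<tau> z a) = cmod (C a) * exp (- (2 * pi * (n a * Im \<tau> + of_int (snd a) * Im z)))" for \<tau> z a
  proof -
    have "of_int ((snd a)\<^sup>2 - fst a) / of_nat (4 * N) = (of_real (n a) :: complex)"
      by (simp add: n_def diff_divide_distrib)
    then have "cmod (t \<tau> z a) = cmod (C a) * cmod (exp (2 * of_real pi * \<i> * (of_real (n a) * \<tau> + of_int (snd a) * z)))"
      unfolding t_def norm_mult by (simp only:)
    then show ?thesis by (simp add: algebra_simps)
  qed
  let ?v0 = "1 / 5 :: real"
  \<comment> \<open>The two points lie over \<tau> = i / 5, the lowest height: z = 0 and z = \<tau>,
    the ends of the range of Im z in the Siegel set.\<close>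
  define e where "e = (\<lambda>a. cmod (t (Complex 0 ?v0) 0 a) + cmod (t (Complex 0 ?v0) (Complex 0 ?v0) a))"
  have "e summable_on admissible N"
    unfolding e_def
    by (intro summable_on_add)
      (use exps [THEN has_sum_imp_summable] in \<open>simp_all add: summable_on_iff_abs_summable_on_complex\<close>)
  then obtain M where M: "(e has_sum M) (admissible N)" by (auto simp: summable_on_def)
  have pointwise: "cmod (t \<tau> z a) * exp (- (2 * pi * real N * (Im z)\<^sup>2 / Im \<tau>))
      \<le> e a * exp (- (2 * pi * ((Im \<tau> - ?v0) / (4 * real N))))"
    if a: "a \<in> admissible N" and S: "(\<tau>, z) \<in> siegel_set" for a \<tau> z
  proof -
    define v y r where "v = Im \<tau>" and "y = Im z" and "r = real_of_int (snd a)"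
    have v: "v \<ge> ?v0" and y: "0 \<le> y" "y \<le> v" using S by (auto simp: siegel_set_def v_def y_def)
    \<comment> \<open>Measuring y in units of v makes the whole exponent v times \<open>X\<close>,
      where \<open>X\<close> depends on z only through \<open>\<mu>\<close> in [0, 1].\<close>
    define \<mu> where "\<mu> = y / v"
    have \<mu>: "0 \<le> \<mu>" "\<mu> \<le> 1" and y\<mu>: "y = \<mu> * v" using v y by (auto simp: \<mu>_def)
    text \<open>Completing the square shows that the exponent \<open>X\<close> is bounded below by \<open>- D / 4N\<close>.\<close>
    define X where "X = n a + r * \<mu> + real N * \<mu>\<^sup>2"
    have D: "fst a \<le> - 1" using a by (auto simp: admissible_def)
    have "X = real N * (\<mu> + r / (2 * real N))\<^sup>2 - of_int (fst a) / (4 * real N)"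
      using N by (simp add: X_def n_def r_def [symmetric] field_simps power2_eq_square)
    moreover have "real N * (\<mu> + r / (2 * real N))\<^sup>2 \<ge> 0" by simp
    moreover have "- (of_int (fst a) / (4 * real N)) \<ge> 1 / (4 * real N)"
      using D N by (simp add: field_simps)
    ultimately have X: "X \<ge> 1 / (4 * real N)" by linarith
    have vX: "n a * v + r * y + real N * y\<^sup>2 / v = v * X"
      using v by (simp add: X_def y\<mu> field_simps power2_eq_square)
    have "cmod (t \<tau> z a) * exp (- (2 * pi * real N * (Im z)\<^sup>2 / Im \<tau>)) = cmod (C a) * exp (- (2 * pi * (v * X)))"
      unfolding norm_t v_def [symmetric] y_def [symmetric] r_def [symmetric]
    proof -
      have "exp (- (2 * pi * (n a * v + r * y))) * exp (- (2 * pi * real N * y\<^sup>2 / v))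
          = exp (- (2 * pi * (n a * v + r * y + real N * y\<^sup>2 / v)))"
        by (simp add: exp_add [symmetric] ring_distribs mult.assoc)
      then show "cmod (C a) * exp (- (2 * pi * (n a * v + r * y))) * exp (- (2 * pi * real N * y\<^sup>2 / v))
          = cmod (C a) * exp (- (2 * pi * (v * X)))"
        unfolding vX by (simp only: mult.assoc)
    qed
    \<comment> \<open>Splitting v X at the height 1 / 5: the first factor is compared with
      \<open>e a\<close>, and the second gives the decay through X \<ge> 1 / 4N.\<close>
    also have "\<dots> = cmod (C a) * exp (- (2 * pi * (?v0 * X))) * exp (- (2 * pi * ((v - ?v0) * X)))"
      by (simp add: mult.assoc exp_add [symmetric]) (simp add: algebra_simps)
    also have "\<dots> \<le> e a * exp (- (2 * pi * ((v - ?v0) / (4 * real N))))"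
    proof (rule mult_mono)
      have "(v - ?v0) * X \<ge> (v - ?v0) * (1 / (4 * real N))" using v X by (intro mult_left_mono) auto
      then have "2 * pi * ((v - ?v0) / (4 * real N)) \<le> 2 * pi * ((v - ?v0) * X)"
        by (intro mult_left_mono) auto
      then show "exp (- (2 * pi * ((v - ?v0) * X))) \<le> exp (- (2 * pi * ((v - ?v0) / (4 * real N))))"
        by (simp only: exp_le_cancel_iff neg_le_iff_le)
      text \<open>\<open>X \<ge> n + r \<mu>\<close> is at least the smaller of the values at \<open>\<mu> = 0\<close> and \<open>\<mu> = 1\<close>.\<close>
      have "exp (- (2 * pi * (?v0 * X))) \<le> exp (- (2 * pi * (n a * ?v0 + 0))) + exp (- (2 * pi * (n a * ?v0 + r * ?v0)))"
      proof (cases "r \<ge> 0")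
        case True
        then have "X \<ge> n a" using \<mu> by (simp add: X_def)
        then have "exp (- (2 * pi * (?v0 * X))) \<le> exp (- (2 * pi * (n a * ?v0 + 0)))" by simp
        then show ?thesis by (smt (verit) exp_gt_zero)
      next
        case False
        then have "r * \<mu> \<ge> r * 1" using \<mu> by (intro mult_left_mono_neg) auto
        then have "X \<ge> n a + r" by (simp add: X_def add_increasing2)
        then have "n a * ?v0 + r * ?v0 \<le> ?v0 * X" by simp
        then have "2 * pi * (n a * ?v0 + r * ?v0) \<le> 2 * pi * (?v0 * X)"
          by (intro mult_left_mono) auto
        then have "exp (- (2 * pi * (?v0 * X))) \<le> exp (- (2 * pi * (n a * ?v0 + r * ?v0)))"
          by (simp only: exp_le_cancel_iff neg_le_iff_le)
        then show ?thesis by (smt (verit) exp_gt_zero)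
      qed
      then have "cmod (C a) * exp (- (2 * pi * (?v0 * X)))
          \<le> cmod (C a) * (exp (- (2 * pi * (n a * ?v0 + 0))) + exp (- (2 * pi * (n a * ?v0 + r * ?v0))))"
        by (rule mult_left_mono) simp
      also have "\<dots> = e a"
        unfolding e_def norm_t by (simp add: r_def distrib_left)
      finally show "cmod (C a) * exp (- (2 * pi * (?v0 * X))) \<le> e a" .
      then show "0 \<le> e a" by (rule order_trans [rotated]) simp
    qed simp
    finally show ?thesis by (simp add: v_def)
  qed
  have bound: "cmod (\<phi> (\<tau>, z)) * exp (- (2 * pi * real N * (Im z)\<^sup>2 / Im \<tau>))
      \<le> M * exp (- (2 * pi * ((Im \<tau> - ?v0) / (4 * real N))))" if S: "(\<tau>, z) \<in> siegel_set" for \<tau> z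
  proof -
    let ?E = "exp (- (2 * pi * real N * (Im z)\<^sup>2 / Im \<tau>))"
    have "Im \<tau> > 0" using S by (auto simp: siegel_set_def)
    then have "((\<lambda>a. t \<tau> z a * of_real ?E) has_sum \<phi> (\<tau>, z) * of_real ?E) (admissible N)"
      by (intro has_sum_cmult_left exps)
    moreover have "((\<lambda>a. e a * exp (- (2 * pi * ((Im \<tau> - ?v0) / (4 * real N))))) has_sum
        M * exp (- (2 * pi * ((Im \<tau> - ?v0) / (4 * real N))))) (admissible N)"
      by (intro has_sum_cmult_left M)
    ultimately have "cmod (\<phi> (\<tau>, z) * of_real ?E) \<le> M * exp (- (2 * pi * ((Im \<tau> - ?v0) / (4 * real N))))"
      by (rule norm_infsum_le) (use pointwise [OF _ S] in \<open>simp add: norm_mult\<close>)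
    then show ?thesis by (simp add: norm_mult)
  qed
  \<comment> \<open>The decay exp(-2 pi v / 4N) of |\<phi>| is squared in the norm.\<close>
  define c where "c = pi / real N"
  have c: "c > 0" using N by (simp add: c_def)
  obtain K where K: "\<And>v. v \<ge> ?v0 \<Longrightarrow> v powi k * exp (- c * v) \<le> K"
    using powi_times_exp_bounded [OF c, of ?v0 k] by (auto simp: mult.commute)
  show ?thesis
  proof (intro exI ballI)
    fix p assume p: "p \<in> siegel_set"
    obtain \<tau> z where pz: "p = (\<tau>, z)" by fastforce
    have v: "Im \<tau> \<ge> ?v0" using p by (simp add: siegel_set_def pz)
    have "jacobi_norm k N \<phi> p = Im \<tau> powi k * (cmod (\<phi> (\<tau>, z)) * exp (- (2 * pi * real N * (Im z)\<^sup>2 / Im \<tau>)))\<^sup>2"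
    proof -
      have "(exp (- (2 * pi * real N * (Im z)\<^sup>2 / Im \<tau>)))\<^sup>2 = exp (- 4 * pi * real N * (Im z)\<^sup>2 / Im \<tau>)"
        by (simp add: power2_eq_square [of "exp _"] exp_add [symmetric])
      then show ?thesis unfolding jacobi_norm_def pz fst_conv snd_conv power_mult_distrib by (simp only: mult_ac)
    qed
    also have "\<dots> \<le> Im \<tau> powi k * (M * exp (- (2 * pi * ((Im \<tau> - ?v0) / (4 * real N)))))\<^sup>2"
      using v by (intro mult_left_mono power_mono bound) (use p pz in auto)
    also have "(M * exp (- (2 * pi * ((Im \<tau> - ?v0) / (4 * real N)))))\<^sup>2 = M\<^sup>2 * exp (c * ?v0) * exp (- c * Im \<tau>)"
      using N unfolding power_mult_distrib c_def
      by (simp add: power2_eq_square [of "exp _"] mult.assoc exp_add [symmetric]) (simp add: field_simps)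
    also have "Im \<tau> powi k * (M\<^sup>2 * exp (c * ?v0) * exp (- c * Im \<tau>)) = M\<^sup>2 * exp (c * ?v0) * (Im \<tau> powi k * exp (- c * Im \<tau>))"
      by (simp only: mult_ac)
    also have "\<dots> \<le> M\<^sup>2 * exp (c * ?v0) * K"
      by (intro mult_left_mono K v) simp
    finally show "jacobi_norm k N \<phi> p \<le> M\<^sup>2 * exp (c * ?v0) * K" .
  qed
qed

lemma nn_integral_jacobi_norm_finite:
  assumes N: "N \<ge> 1" and F: "jacobi_fundamental_domain F" and \<phi>: "\<phi> \<in> jacobi_cusp_forms k N"
  shows "(\<integral>\<^sup>+p. ennreal (jacobi_norm k N \<phi> p) * indicator F p \<partial>jacobi_measure) < \<infinity>"
proof -
  obtain K where K: "\<forall>p\<in>siegel_set. jacobi_norm k N \<phi> p \<le> K"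
    using jacobi_norm_bounded_on_siegel_set [OF N \<phi>] ..
  have [measurable]: "jacobi_norm k N \<phi> \<in> borel_measurable borel"
    by (rule measurable_jacobi_norm [OF \<phi>])
  have "(\<integral>\<^sup>+p. ennreal (jacobi_norm k N \<phi> p) * indicator F p \<partial>jacobi_measure)
      \<le> (\<integral>\<^sup>+p. ennreal (jacobi_norm k N \<phi> p) * indicator siegel_set p \<partial>jacobi_measure)"
  proof (rule nn_integral_fundamental_domain_le [OF F])
    show "ennreal (jacobi_norm k N \<phi> (jacobi_act g p)) = ennreal (jacobi_norm k N \<phi> p)"
      if "g \<in> jacobi_group" "p \<in> jacobi_space" for g p
      by (simp only: jacobi_norm_act [OF \<phi> that])
    show "(\<lambda>p. ennreal (jacobi_norm k N \<phi> p)) \<in> borel_measurable borel" by measurable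
  qed (fact sets_siegel_set, rule siegel_set_covers)
  also have "\<dots> \<le> (\<integral>\<^sup>+p. ennreal K * indicator siegel_set p \<partial>jacobi_measure)"
    by (intro nn_integral_mono) (auto simp: indicator_def intro!: ennreal_leI K [rule_format])
  also have "\<dots> = ennreal K * emeasure jacobi_measure siegel_set"
    by (rule nn_integral_cmult_indicator) simp
  also have "\<dots> < \<infinity>"
    using emeasure_siegel_set_finite by (simp add: ennreal_mult_less_top)
  finally show ?thesis .
qed

section \<open>The Petersson product\<close>

definition petersson_integrand ::
  "int \<Rightarrow> nat \<Rightarrow> (complex \<times> complex \<Rightarrow> complex) \<Rightarrow> (complex \<times> complex \<Rightarrow> complex) \<Rightarrow> complex \<times> complex \<Rightarrow> complex"
  where "petersson_integrand k N \<phi> \<psi> p = \<phi> p * cnj (\<psi> p) *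
    of_real (Im (fst p) powi (k - 3) * exp (- 4 * pi * real N * (Im (snd p))\<^sup>2 / Im (fst p)))"

lemma petersson_eq:
  "petersson F k N \<phi> \<psi> = set_lebesgue_integral lborel F (petersson_integrand k N \<phi> \<psi>)"
  unfolding petersson_def petersson_integrand_def by (simp add: case_prod_unfold)

lemma petersson_integrand_eq:
  assumes "p \<in> jacobi_space"
  shows "petersson_integrand k N \<phi> \<psi> p = \<phi> p * cnj (\<psi> p) *
    of_real (Im (fst p) powi k * exp (- 4 * pi * real N * (Im (snd p))\<^sup>2 / Im (fst p)) * (1 / Im (fst p) ^ 3))"
proof -
  have "Im (fst p) > 0" using assms by (auto simp: jacobi_space_def)
  then have "Im (fst p) powi (k - 3) = Im (fst p) powi k * (1 / Im (fst p) ^ 3)"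
    by (simp add: power_int_diff)
  then show ?thesis unfolding petersson_integrand_def by (simp only: mult_ac)
qed

text \<open>Reduces integrability of a mixed product to that of the two invariant norms, the only
  functions to which the comparison with the Siegel set applies.\<close>

lemma norm_petersson_integrand_le:
  assumes "p \<in> jacobi_space"
  shows "cmod (petersson_integrand k N \<phi> \<psi> p)
    \<le> (jacobi_norm k N \<phi> p + jacobi_norm k N \<psi> p) * (1 / Im (fst p) ^ 3)"
proof -
  have v: "Im (fst p) > 0" using assms by (auto simp: jacobi_space_def)
  define w where "w = Im (fst p) powi k * exp (- 4 * pi * real N * (Im (snd p))\<^sup>2 / Im (fst p))"
  have w: "w \<ge> 0" using v by (simp add: w_def)
  have "cmod (petersson_integrand k N \<phi> \<psi> p) = cmod (\<phi> p) * cmod (\<psi> p) * (w * (1 / Im (fst p) ^ 3))"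
    using v w unfolding petersson_integrand_eq [OF assms] w_def [symmetric]
    by (simp add: norm_mult norm_divide norm_power)
  also have "\<dots> \<le> ((cmod (\<phi> p))\<^sup>2 + (cmod (\<psi> p))\<^sup>2) * (w * (1 / Im (fst p) ^ 3))"
  proof (rule mult_right_mono)
    have "0 \<le> (cmod (\<phi> p) - cmod (\<psi> p))\<^sup>2 + (cmod (\<phi> p))\<^sup>2 + (cmod (\<psi> p))\<^sup>2" by simp
    then show "cmod (\<phi> p) * cmod (\<psi> p) \<le> (cmod (\<phi> p))\<^sup>2 + (cmod (\<psi> p))\<^sup>2"
      by (simp add: power2_eq_square algebra_simps)
  qed (use w v in simp)
  also have "\<dots> = (jacobi_norm k N \<phi> p + jacobi_norm k N \<psi> p) * (1 / Im (fst p) ^ 3)"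
    unfolding jacobi_norm_def w_def [symmetric] by (simp only: distrib_right mult.assoc)
  finally show ?thesis .
qed

lemma nn_integral_jacobi_norm_lborel:
  assumes F: "jacobi_fundamental_domain F" and \<phi>: "\<phi> \<in> jacobi_cusp_forms k N"
  shows "(\<integral>\<^sup>+p. ennreal (jacobi_norm k N \<phi> p) * indicator F p \<partial>jacobi_measure)
    = (\<integral>\<^sup>+p. ennreal (jacobi_norm k N \<phi> p * (1 / Im (fst p) ^ 3)) * indicator F p \<partial>lborel)"
proof -
  have [measurable]: "jacobi_norm k N \<phi> \<in> borel_measurable borel"
    by (rule measurable_jacobi_norm [OF \<phi>])
  have [measurable]: "F \<in> sets borel" and sub: "F \<subseteq> jacobi_space"
    using F by (auto simp: jacobi_fundamental_domain_def)
  have "ennreal (1 / Im (fst p) ^ 3) * indicator jacobi_space p * (ennreal (jacobi_norm k N \<phi> p) * indicator F p)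
      = ennreal (jacobi_norm k N \<phi> p * (1 / Im (fst p) ^ 3)) * indicator F p" for p
  proof (cases "p \<in> F")
    case True
    then have "p \<in> jacobi_space" using sub by blast
    then show ?thesis
      using True jacobi_norm_nonneg [OF \<phi>, of p]
      by (subst ennreal_mult) (auto simp: jacobi_space_def mult.commute)
  qed simp
  then show ?thesis
    unfolding jacobi_measure_def by (subst nn_integral_density) simp_all
qed

lemma set_integrable_petersson:
  assumes N: "N \<ge> 1" and F: "jacobi_fundamental_domain F"
    and \<phi>: "\<phi> \<in> jacobi_cusp_forms k N" and \<psi>: "\<psi> \<in> jacobi_cusp_forms k N"
  shows "set_integrable lborel F (petersson_integrand k N \<phi> \<psi>)"
  unfolding set_integrable_def
proof (rule integrableI_bounded)
  have [measurable]: "\<phi> \<in> borel_measurable borel" "\<psi> \<in> borel_measurable borel"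
    using \<phi> \<psi> by (auto intro: measurable_cusp_form)
  have [measurable]: "jacobi_norm k N \<phi> \<in> borel_measurable borel" "jacobi_norm k N \<psi> \<in> borel_measurable borel"
    using \<phi> \<psi> by (auto intro: measurable_jacobi_norm)
  have [measurable]: "F \<in> sets borel" and sub: "F \<subseteq> jacobi_space"
    using F by (auto simp: jacobi_fundamental_domain_def)
  have [measurable]: "cnj \<in> borel_measurable borel"
    by (intro borel_measurable_continuous_onI continuous_intros)
  have "petersson_integrand k N \<phi> \<psi> \<in> borel_measurable borel"
    unfolding petersson_integrand_def by measurable
  then show "(\<lambda>p. indicator F p *\<^sub>R petersson_integrand k N \<phi> \<psi> p) \<in> borel_measurable lborel"
    by measurable
  let ?d = "\<lambda>\<eta> p. ennreal (jacobi_norm k N \<eta> p * (1 / Im (fst p) ^ 3)) * indicator F p"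
  have "(\<integral>\<^sup>+p. norm (indicator F p *\<^sub>R petersson_integrand k N \<phi> \<psi> p) \<partial>lborel)
      \<le> (\<integral>\<^sup>+p. ?d \<phi> p + ?d \<psi> p \<partial>lborel)"
  proof (rule nn_integral_mono)
    fix p
    show "ennreal (norm (indicator F p *\<^sub>R petersson_integrand k N \<phi> \<psi> p)) \<le> ?d \<phi> p + ?d \<psi> p"
    proof (cases "p \<in> F")
      case True
      then have p: "p \<in> jacobi_space" using sub by blast
      then have v: "1 / Im (fst p) ^ 3 \<ge> 0" by (auto simp: jacobi_space_def)
      have "?d \<phi> p + ?d \<psi> p = ennreal ((jacobi_norm k N \<phi> p + jacobi_norm k N \<psi> p) * (1 / Im (fst p) ^ 3))"
        using True v jacobi_norm_nonneg [OF \<phi>, of p] jacobi_norm_nonneg [OF \<psi>, of p]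
        by (simp only: distrib_right) (subst ennreal_plus, auto)
      then show ?thesis
        using True norm_petersson_integrand_le [OF p, of k N \<phi> \<psi>] by (simp add: ennreal_leI)
    qed simp
  qed
  also have "\<dots> = (\<integral>\<^sup>+p. ?d \<phi> p \<partial>lborel) + (\<integral>\<^sup>+p. ?d \<psi> p \<partial>lborel)"
    by (rule nn_integral_add) measurable
  also have "\<dots> < \<infinity>"
    using nn_integral_jacobi_norm_finite [OF N F \<phi>] nn_integral_jacobi_norm_finite [OF N F \<psi>]
    unfolding nn_integral_jacobi_norm_lborel [OF F \<phi>] nn_integral_jacobi_norm_lborel [OF F \<psi>] by simp
  finally show "(\<integral>\<^sup>+p. norm (indicator F p *\<^sub>R petersson_integrand k N \<phi> \<psi> p) \<partial>lborel) < \<infinity>" .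
qed

lemma petersson_add:
  assumes "N \<ge> 1" "jacobi_fundamental_domain F" "\<phi> \<in> jacobi_cusp_forms k N"
    "\<phi>' \<in> jacobi_cusp_forms k N" "\<psi> \<in> jacobi_cusp_forms k N"
  shows "petersson F k N (\<phi> + \<phi>') \<psi> = petersson F k N \<phi> \<psi> + petersson F k N \<phi>' \<psi>"
proof -
  have "petersson_integrand k N (\<phi> + \<phi>') \<psi> = (\<lambda>p. petersson_integrand k N \<phi> \<psi> p + petersson_integrand k N \<phi>' \<psi> p)"
    by (simp add: petersson_integrand_def fun_eq_iff distrib_right)
  then show ?thesis
    unfolding petersson_eq by (simp only: set_integral_add set_integrable_petersson [OF assms(1,2,3,5)]
      set_integrable_petersson [OF assms(1,2,4,5)])
qed

text \<open>A nonintegrable integrand has integral 0, so scaling here and conjugation below commute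
  with the integral for all functions. Additivity, by contrast, rests on
  \<open>set_integrable_petersson\<close>.\<close>

lemma petersson_scale: "petersson F k N (fun_scale c \<phi>) \<psi> = c * petersson F k N \<phi> \<psi>"
proof -
  have "indicator F p *\<^sub>R petersson_integrand k N (fun_scale c \<phi>) \<psi> p
      = c * (indicator F p *\<^sub>R petersson_integrand k N \<phi> \<psi> p)" for p
    by (simp add: petersson_integrand_def fun_scale_def mult_ac)
  then show ?thesis
    unfolding petersson_eq set_lebesgue_integral_def by (simp only: integral_mult_right_zero)
qed

lemma petersson_cnj: "petersson F k N \<psi> \<phi> = cnj (petersson F k N \<phi> \<psi>)"
proof -
  have "indicator F p *\<^sub>R petersson_integrand k N \<psi> \<phi> p = cnj (indicator F p *\<^sub>R petersson_integrand k N \<phi> \<psi> p)" for p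
    by (simp add: petersson_integrand_def mult_ac)
  then show ?thesis
    unfolding petersson_eq set_lebesgue_integral_def by (simp only: Bochner_Integration.integral_cnj)
qed

text \<open>F may have empty interior, so continuity cannot be used on F itself. The vanishing is
  first spread from F to almost all of \<open>jacobi_space\<close>. There the set where \<phi> is
  nonzero is open and null, hence empty.\<close>

lemma petersson_definite:
  assumes N: "N \<ge> 1" and F: "jacobi_fundamental_domain F" and \<phi>: "\<phi> \<in> jacobi_cusp_forms k N"
    and zero: "petersson F k N \<phi> \<phi> = 0"
  shows "\<phi> = 0"
proof -
  define f where "f = (\<lambda>p. indicator F p * (jacobi_norm k N \<phi> p * (1 / Im (fst p) ^ 3)))"
  have sub: "F \<subseteq> jacobi_space"
    using F by (auto simp: jacobi_fundamental_domain_def)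
  have f: "indicator F p *\<^sub>R petersson_integrand k N \<phi> \<phi> p = of_real (f p)" for p
  proof (cases "p \<in> F")
    case True
    then have p: "p \<in> jacobi_space" using sub by blast
    show ?thesis
      using True unfolding petersson_integrand_eq [OF p] f_def jacobi_norm_def complex_norm_square [symmetric]
      by simp
  qed (simp add: f_def)
  have f0: "f p \<ge> 0" for p
    using sub jacobi_norm_nonneg [OF \<phi>, of p]
    by (cases "p \<in> F") (auto simp: f_def jacobi_space_def)
  have "integrable lborel (\<lambda>p. of_real (f p) :: complex)"
    using set_integrable_petersson [OF N F \<phi> \<phi>] unfolding set_integrable_def f .
  then have fi: "integrable lborel f"
    using complex_of_real_integrable_eq by blast
  have "of_real (integral\<^sup>L lborel f) = (0 :: complex)"
    using zero unfolding petersson_eq set_lebesgue_integral_def f by simp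
  then have "(\<integral>\<^sup>+p. ennreal (f p) \<partial>lborel) = 0"
    using nn_integral_eq_integral [OF fi] f0 by simp
  moreover have "ennreal (f p) = ennreal (jacobi_norm k N \<phi> p * (1 / Im (fst p) ^ 3)) * indicator F p" for p
    by (simp add: f_def indicator_def)
  ultimately have "(\<integral>\<^sup>+p. ennreal (jacobi_norm k N \<phi> p) * indicator F p \<partial>jacobi_measure) = 0"
    unfolding nn_integral_jacobi_norm_lborel [OF F \<phi>] by simp
  then have "AE p in lborel. p \<in> jacobi_space \<longrightarrow> ennreal (jacobi_norm k N \<phi> p) = 0"
    using measurable_jacobi_norm [OF \<phi>]
    by (intro AE_eq_0_if_fundamental_domain [OF F]) (simp_all del: jacobi_act.simps add: jacobi_norm_act [OF \<phi>])
  then have AE: "AE p in lborel. p \<notin> {p \<in> jacobi_space. \<phi> p \<noteq> 0}"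
  proof (rule eventually_mono)
    fix p
    assume *: "p \<in> jacobi_space \<longrightarrow> ennreal (jacobi_norm k N \<phi> p) = 0"
    show "p \<notin> {p \<in> jacobi_space. \<phi> p \<noteq> 0}"
    proof
      assume p: "p \<in> {p \<in> jacobi_space. \<phi> p \<noteq> 0}"
      then have "Im (fst p) > 0" by (auto simp: jacobi_space_def)
      then have "Im (fst p) powi k > 0" by simp
      with p have "jacobi_norm k N \<phi> p > 0" by (simp add: jacobi_norm_def)
      with * p show False by simp
    qed
  qed
  have "open {p \<in> jacobi_space. \<phi> p \<noteq> 0}"
  proof -
    have "{p \<in> jacobi_space. \<phi> p \<noteq> 0} = jacobi_space \<inter> \<phi> -` (- {0})" by auto
    then show ?thesis
      by (simp only:) (intro continuous_open_preimage continuous_on_cusp_form [OF \<phi>] open_jacobi_space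
        open_Compl closed_singleton)
  qed
  moreover have "negligible {p \<in> jacobi_space. \<phi> p \<noteq> 0}"
  proof -
    have "{p \<in> jacobi_space. \<phi> p \<noteq> 0} \<in> null_sets lborel"
      using AE \<open>open _\<close> by (subst AE_iff_null_sets) auto
    then show ?thesis by (simp add: negligible_iff_null_sets null_sets_completionI)
  qed
  ultimately have "{p \<in> jacobi_space. \<phi> p \<noteq> 0} = {}" using open_not_negligible by blast
  then show ?thesis using cusp_form_outside [OF \<phi>] by (auto simp: fun_eq_iff)
qed

theorem theorem1:
  fixes k :: int and N :: nat
    and F :: "(complex \<times> complex) set"
    and h :: "(int \<times> int) list"
    and \<phi> \<psi> :: "complex \<times> complex \<Rightarrow> complex"
  assumes "N \<ge> 1"
    and "jacobi_fundamental_domain F"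
    and "length h = cfun.dim (jacobi_cusp_forms k N)"
    and "set h \<subseteq> admissible N"
    and "distinct (map (poincare F k N) h)"
    and "cfun.independent (poincare F k N ` set h)"
    and "cfun.span (poincare F k N ` set h) = jacobi_cusp_forms k N"
    and "\<phi> \<in> jacobi_cusp_forms k N" and "\<psi> \<in> jacobi_cusp_forms k N"
  shows "\<exists>G. mat_inverse (gram_mat F k N h) = Some G \<and>
    petersson F k N \<phi> \<psi> =
      scalar_prod (coeff_vec N h \<phi>) (G *\<^sub>v map_vec cnj (coeff_vec N h \<psi>))"
proof -
  interpret definite_hermitian_form "map (poincare F k N) h" "petersson F k N" "jacobi_cusp_forms k N"
  proof
    show "petersson F k N y x = cnj (petersson F k N x y)" for x y by (rule petersson_cnj)
  qed (use assms petersson_add [OF assms(1,2)] petersson_scale petersson_definite [OF assms(1,2)] in auto)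
  \<comment> \<open>Riesz representation is applied to the coefficient functional at
    \<open>a\<close>. Existence and uniqueness together make the description in
    \<open>poincare\<close> denote.\<close>
  have poincare: "petersson F k N \<eta> (poincare F k N a) = jacobi_coeff N \<eta> a"
    if "\<eta> \<in> jacobi_cusp_forms k N" for \<eta> a
  proof -
    have "\<exists>!P. P \<in> jacobi_cusp_forms k N \<and>
        (\<forall>\<eta>\<in>jacobi_cusp_forms k N. petersson F k N \<eta> P = jacobi_coeff N \<eta> a)"
      by (rule riesz_representation [OF jacobi_coeff_add [OF assms(1)] jacobi_coeff_scale [OF assms(1)]])
    from theI' [OF this] that show ?thesis unfolding poincare_def by blast
  qed
  have in_V: "poincare F k N (h ! i) \<in> jacobi_cusp_forms k N" if "i < length h" for i
    using nth_in_V [of i] that by simp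
  \<comment> \<open>Each P_h(i) is itself a cusp form, so its coefficient at h(j) is its product
    with P_h(j).\<close>
  have gram: "gram_mat F k N h = gram"
    unfolding gram_mat_def gram_def by (rule eq_matI) (simp_all add: poincare in_V)
  have coeff: "coeff_vec N h \<eta> = vec (length (map (poincare F k N) h)) (\<lambda>i. petersson F k N \<eta> (map (poincare F k N) h ! i))"
    if "\<eta> \<in> jacobi_cusp_forms k N" for \<eta>
    unfolding coeff_vec_def by (rule eq_vecI) (simp_all add: poincare that)
  obtain H where H: "mat_inverse gram = Some H"
      "H \<in> carrier_mat (length (map (poincare F k N) h)) (length (map (poincare F k N) h))"
      "H * gram = 1\<^sub>m (length (map (poincare F k N) h))"
    by (rule gram_inverse)
  from form_eq_gram_inverse [OF assms(8,9) H(2,3)] show ?thesis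
    unfolding gram coeff [OF assms(8)] coeff [OF assms(9)] using H(1) by blast
qed

end
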